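(* Let $(X,d_X)$ and $(Y,d_Y)$ be polyhedral Hilbert geometries with $\dim X=\dim Y=n\geq 2$. If there exists an isometry $g\colon X\to Y$ (onto) whose induced map $\hat g$ on Busemann points maps vertex parts of $X$ to facet parts of $Y$, then $X$ and $Y$ are open $n$-simplices.
   Context: A polyhedral Hilbert geometry is a nonempty bounded set $X\subseteq\mathbb{R}^n$ which is the intersection of finitely many open half-spaces, with Hilbert metric $d_X(x,y)=\log\frac{|x'y|\,|y'x|}{|x'x|\,|y'y|}$ ($x',y'\in\partial X$ the endpoints of the chord through $x,y$, with $x',x,y,y'$ in order; $d_X(x,x)=0$). Horoboundary: fix a base-point $b\in X$; for $z\in X$ let $\phi_z(w)=d_X(w,z)-d_X(b,z)$; with the topology of uniform convergence on compacts, horofunctions are the limit points of $\{\phi_z\}$ not of the form $\phi_z$. A path $\gamma\colon T\to X$ ($T\subseteq\mathbb{R}$ unbounded, $0\in T$) is an almost-geodesic if for every $\epsilon>0$ there is $M$ with $|d(\gamma(t),\gamma(s))+d(\gamma(s),\gamma(0))-t|<\epsilon$ for all $t\geq s\geq M$ in $T$; Busemann points are horofunctions that are limits along almost-geodesics. Detour cost $H(\xi,\eta)=\inf_\gamma\liminf_{t\to\infty}(d(b,\gamma(t))+\eta(\gamma(t)))$ over paths $\gamma$ with $\phi_{\gamma(t)}\to\xi$; detour metric $\delta=H(\xi,\eta)+H(\eta,\xi)$; parts are the classes of Busemann points under $\delta(\xi,\eta)<\infty$. An isometry $g$ induces $\hat g(\xi)(y)=\xi(g^{-1}(y))-\xi(g^{-1}(b_Y))$,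 which maps parts onto parts. Description of parts: embed $X$ as $\{(x,1)\}\subseteq\mathbb{R}^{n+1}$, $C_X=\{\lambda(x,1)\colon\lambda>0,x\in X\}$. With $M(y/x;K)=\inf\{\lambda>0\colon\lambda x-y\in\overline K\}$, $\mathcal F_K(x,y)=\log M(x/y;K)$, $\mathcal{RF}_K(x,y)=\log M(y/x;K)$, $\tau(C,z)=\{\lambda(w-z)\colon\lambda>0,w\in C\}$, $\Gamma(\Pi)=\{\tau(T,z)\colon T\in\Pi,z\in\partial T\}$, $\mathcal T(C)=\bigcup_{k=1}^n\Gamma^k(\{C\})$, $f_{T,p}(w)=\mathcal F_T(w,p)-\mathcal F_T(b,p)$, $r_{C,z}(w)=\mathcal{RF}_C(w,z)-\mathcal{RF}_C(b,z)$: the Busemann points are the restrictions to $X$ of $r_{C_X,x}+f_{U,p}$ with $x\in\partial C_X\setminus\{0\}$, $U\in\mathcal T(\tau(C_X,x))$, $p\in U$, and the parts are the sets $P(F,U)=\{r_{C_X,x}+f_{U,p}\colon x\in F,p\in U\}$, $F$ the relative interior of a nonzero proper face of $\overline{C_X}$, $U\in\mathcal T(\tau(C_X,z))$, $z\in F$. A vertex part is $P(F,\tau(C_X,z))$ with $F$ the open ray through $(v,1)$, $v$ a vertex of $\overline X$; a facet part is $P(F,\tau(C_X,z))$ with $F$ the relative interior of an $n$-dimensional face of $\overline{C_X}$, $z\in F$. An open $n$-simplex is the interior of the convex hull of $n+1$ affinely independent points. *)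

theory Defs
  imports "HOL-Analysis.Analysis"
begin

text \<open>Ambient space: \<open>'a\<close> (a Euclidean space of dimension n = DIM('a)); the
  space R^(n+1) is modelled as \<open>'a \<times> real\<close>, with X embedded as {(x,1)}.\<close>

definition polyhedral_hilbert :: "'a::euclidean_space set \<Rightarrow> bool" where
  "polyhedral_hilbert X \<longleftrightarrow> X \<noteq> {} \<and> bounded X \<and>
     (\<exists>H :: ('a \<times> real) set. finite H \<and> (\<forall>(a,c)\<in>H. a \<noteq> 0) \<and>
        X = (\<Inter>(a,c)\<in>H. {x. a \<bullet> x < c}))"

definition chord_end :: "'a::euclidean_space set \<Rightarrow> 'a \<Rightarrow> 'a \<Rightarrow> 'a" where
  "chord_end X x y = (THE p. p \<in> frontier X \<and> (\<exists>t>0. p = x + t *\<^sub>R (x - y)))"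

definition hilbert_dist :: "'a::euclidean_space set \<Rightarrow> 'a \<Rightarrow> 'a \<Rightarrow> real" where
  "hilbert_dist X x y =
     (if x = y then 0 else
        (let x' = chord_end X x y; y' = chord_end X y x in
          ln ((dist x' y * dist y' x) / (dist x' x * dist y' y))))"

definition lift :: "'a::euclidean_space \<Rightarrow> 'a \<times> real" where
  "lift x = (x, 1)"

definition cone_over :: "'a::euclidean_space set \<Rightarrow> ('a \<times> real) set" where
  "cone_over X = {l *\<^sub>R lift x | l x. l > 0 \<and> x \<in> X}"

definition Mfun :: "('b::real_normed_vector) set \<Rightarrow> 'b \<Rightarrow> 'b \<Rightarrow> real" where
  "Mfun K y x = Inf {l. l > 0 \<and> l *\<^sub>R x - y \<in> closure K}"

definition funk :: "('b::real_normed_vector) set \<Rightarrow> 'b \<Rightarrow> 'b \<Rightarrow> real" where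
  "funk K x y = ln (Mfun K x y)"

definition rev_funk :: "('b::real_normed_vector) set \<Rightarrow> 'b \<Rightarrow> 'b \<Rightarrow> real" where
  "rev_funk K x y = ln (Mfun K y x)"

definition tangent_cone :: "('b::real_normed_vector) set \<Rightarrow> 'b \<Rightarrow> 'b set" where
  "tangent_cone C z = {l *\<^sub>R (w - z) | l w. l > 0 \<and> w \<in> C}"

definition f_fun :: "'a::euclidean_space \<Rightarrow> ('a \<times> real) set \<Rightarrow> ('a \<times> real) \<Rightarrow> 'a \<Rightarrow> real" where
  "f_fun b T p w = funk T (lift w) p - funk T (lift b) p"

definition r_fun :: "'a::euclidean_space \<Rightarrow> ('a \<times> real) set \<Rightarrow> ('a \<times> real) \<Rightarrow> 'a \<Rightarrow> real" where
  "r_fun b C z w = rev_funk C (lift w) z - rev_funk C (lift b) z"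

text \<open>Functions on X are represented as total functions that are 0 outside X.\<close>
definition restr :: "'a set \<Rightarrow> ('a \<Rightarrow> real) \<Rightarrow> 'a \<Rightarrow> real" where
  "restr X h = (\<lambda>w. if w \<in> X then h w else 0)"

definition part_set :: "'a::euclidean_space set \<Rightarrow> 'a \<Rightarrow> ('a \<times> real) set \<Rightarrow> ('a \<times> real) set
    \<Rightarrow> ('a \<Rightarrow> real) set" where
  "part_set X b F U =
     {restr X (\<lambda>w. r_fun b (cone_over X) x w + f_fun b U p w) | x p. x \<in> F \<and> p \<in> U}"

definition vertex_part :: "'a::euclidean_space set \<Rightarrow> 'a \<Rightarrow> ('a \<Rightarrow> real) set \<Rightarrow> bool" where
  "vertex_part X b P \<longleftrightarrow>
     (\<exists>v F z. v extreme_point_of (closure X) \<and> F = {l *\<^sub>R lift v | l. l > 0} \<and> z \<in> F \<and>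
        P = part_set X b F (tangent_cone (cone_over X) z))"

definition facet_part :: "'a::euclidean_space set \<Rightarrow> 'a \<Rightarrow> ('a \<Rightarrow> real) set \<Rightarrow> bool" where
  "facet_part X b P \<longleftrightarrow>
     (\<exists>G F z. G face_of (closure (cone_over X)) \<and> aff_dim G = int DIM('a) \<and>
        F = rel_interior G \<and> z \<in> F \<and>
        P = part_set X b F (tangent_cone (cone_over X) z))"

definition induced_map :: "'a set \<Rightarrow> 'b set \<Rightarrow> 'b \<Rightarrow> ('a \<Rightarrow> 'b) \<Rightarrow> ('a \<Rightarrow> real) \<Rightarrow> 'b \<Rightarrow> real" where
  "induced_map X Y bY g \<xi> =
     (\<lambda>y. if y \<in> Y then \<xi> (inv_into X g y) - \<xi> (inv_into X g bY) else 0)"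

definition open_simplex :: "'a::euclidean_space set \<Rightarrow> bool" where
  "open_simplex X \<longleftrightarrow> (\<exists>S. finite S \<and> card S = DIM('a) + 1 \<and> \<not> affine_dependent S \<and>
                          X = interior (convex hull S))"

end

theory Submission
  imports Defs
begin

text \<open>The cones over X and Y are cut out by finite irredundant sets \<open>A\<close> and \<open>B\<close> of linear functionals.
  After exponentiation, an element of the vertex part of \<open>v\<close> is a product of two maxima of quotients
  of functionals and depends on a point \<open>p\<close> of the tangent cone at \<open>v\<close>; an element of the facet part
  of \<open>a \<in> B\<close> depends on a point \<open>x\<close> of that facet. The induced map therefore sets up a correspondence
  \<open>p \<leftrightarrow> x\<close>. Comparing suprema of quotients shows that it reverses the gauges of the two cones, and
  comparing infima of products of functions from the parts of two vertices \<open>v \<noteq> v'\<close> shows that the facets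
  \<open>a \<noteq> a'\<close> differ and that the functional \<open>a'\<close>, restricted to the facet of \<open>a\<close>, is the gauge of \<open>v'\<close>
  in the tangent cone at \<open>v\<close>. As a gauge it is a maximum of finitely many concave functions; being
  linear as well, it forces the facet of \<open>a\<close> to be a pyramid over its intersection with the facet of
  \<open>a'\<close>. The apexes of these pyramids are dual to the functionals, so X has at most \<open>n + 1\<close> vertices,
  and the dual basis spans the closed cone over Y.\<close>

section \<open>Polyhedral cones given by functionals, and their gauges\<close>

definition opencone :: "'b::real_inner set \<Rightarrow> 'b set" where
  "opencone A = {u. \<forall>a\<in>A. a \<bullet> u > 0}"

definition closedcone :: "'b::real_inner set \<Rightarrow> 'b set" where
  "closedcone A = {u. \<forall>a\<in>A. a \<bullet> u \<ge> 0}"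

text \<open>These functionals alone cut out the tangent cone at \<open>z\<close>; see
  \<open>tangent_cone_opencone\<close>.\<close>

definition active :: "'b::real_inner set \<Rightarrow> 'b \<Rightarrow> 'b set" where
  "active A z = {a \<in> A. a \<bullet> z = 0}"

text \<open>Strictness on the other functionals makes this the relatively open facet, and empty when
  \<open>a\<close> is redundant.\<close>

definition facet :: "'b::real_inner set \<Rightarrow> 'b \<Rightarrow> 'b set" where
  "facet B a = {u. a \<bullet> u = 0 \<and> (\<forall>b\<in>B - {a}. b \<bullet> u > 0)}"

definition irredundant :: "'b::real_inner set \<Rightarrow> bool" where
  "irredundant A \<longleftrightarrow> (\<forall>a\<in>A. facet A a \<noteq> {})"

text \<open>For \<open>x\<close> in the open cone this is the gauge
  \<open>Mfun (opencone A) y x\<close>; see \<open>Mfun_opencone\<close>. It is also used with both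
  points on one facet: the functional vanishing there contributes \<open>0 / 0 = 0\<close>, which is
  harmless because the other quotients are nonnegative.\<close>

definition mx :: "'b::real_inner set \<Rightarrow> 'b \<Rightarrow> 'b \<Rightarrow> real" where
  "mx A y x = Max ((\<lambda>a. (a \<bullet> y) / (a \<bullet> x)) ` A)"

lemma mx_ge: "finite A \<Longrightarrow> a \<in> A \<Longrightarrow> (a \<bullet> y) / (a \<bullet> x) \<le> mx A y x"
  unfolding mx_def by (intro Max_ge) auto

lemma mx_le: "finite A \<Longrightarrow> A \<noteq> {} \<Longrightarrow> (\<And>a. a \<in> A \<Longrightarrow> (a \<bullet> y) / (a \<bullet> x) \<le> c) \<Longrightarrow> mx A y x \<le> c"
  unfolding mx_def by (subst Max_le_iff) auto

lemma mx_attained: "finite A \<Longrightarrow> A \<noteq> {} \<Longrightarrow> \<exists>a\<in>A. mx A y x = (a \<bullet> y) / (a \<bullet> x)"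
  unfolding mx_def using Max_in[of "(\<lambda>a. (a \<bullet> y) / (a \<bullet> x)) ` A"] by blast

lemma mx_scale_left:
  assumes "finite A" "A \<noteq> {}" "0 \<le> c"
  shows "mx A (c *\<^sub>R y) x = c * mx A y x"
proof (rule antisym)
  show "mx A (c *\<^sub>R y) x \<le> c * mx A y x"
  proof (rule mx_le[OF assms(1,2)])
    fix a assume "a \<in> A"
    then show "a \<bullet> c *\<^sub>R y / (a \<bullet> x) \<le> c * mx A y x"
      using mult_left_mono[OF mx_ge[OF assms(1), of a y x] assms(3)] by simp
  qed
  obtain a where a: "a \<in> A" "mx A y x = (a \<bullet> y) / (a \<bullet> x)"
    using mx_attained[OF assms(1,2)] by blast
  show "c * mx A y x \<le> mx A (c *\<^sub>R y) x"
    using mx_ge[OF assms(1) a(1), of "c *\<^sub>R y" x] a(2) by simp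
qed

lemma mx_scale_right:
  assumes "finite A" "A \<noteq> {}" "0 < c"
  shows "mx A y (c *\<^sub>R x) = mx A y x / c"
proof -
  have "mx A y (c *\<^sub>R x) = mx A ((1 / c) *\<^sub>R y) x"
    unfolding mx_def by (intro arg_cong[where f=Max] image_cong) (auto simp: field_simps)
  then show ?thesis using mx_scale_left[OF assms(1,2), of "1 / c" y x] assms(3) by simp
qed

lemma mx_pos:
  assumes "finite A" "x \<in> opencone A" "a \<in> A" "a \<bullet> y > 0"
  shows "mx A y x > 0"
proof -
  have "0 < (a \<bullet> y) / (a \<bullet> x)" using assms by (auto simp: opencone_def)
  with mx_ge[OF assms(1,3), of y x] show ?thesis by linarith
qed

lemma mx_pos_opencone:
  assumes "finite A" "A \<noteq> {}" "x \<in> opencone A" "y \<in> opencone A"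
  shows "mx A y x > 0"
  using assms mx_pos[OF assms(1,3)] by (auto simp: opencone_def)

lemma opencone_subset_closedcone: "opencone A \<subseteq> closedcone A"
  by (auto simp: opencone_def closedcone_def less_imp_le)

lemma opencone_scale: "u \<in> opencone A \<Longrightarrow> 0 < c \<Longrightarrow> c *\<^sub>R u \<in> opencone A"
  by (auto simp: opencone_def)

lemma closedcone_scale: "u \<in> closedcone A \<Longrightarrow> 0 \<le> c \<Longrightarrow> c *\<^sub>R u \<in> closedcone A"
  by (auto simp: closedcone_def)

lemma closedcone_add: "u \<in> closedcone A \<Longrightarrow> w \<in> closedcone A \<Longrightarrow> u + w \<in> closedcone A"
  by (auto simp: closedcone_def inner_add_right)

lemma closedcone_add_opencone: "u \<in> closedcone A \<Longrightarrow> w \<in> opencone A \<Longrightarrow> u + w \<in> opencone A"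
  by (fastforce simp: closedcone_def opencone_def inner_add_right intro: add_nonneg_pos)

lemma facet_subset_closedcone: "facet B a \<subseteq> closedcone B"
proof
  fix u assume "u \<in> facet B a"
  then have "0 \<le> b \<bullet> u" if "b \<in> B" for b
    using that by (cases "b = a") (auto simp: facet_def less_imp_le)
  then show "u \<in> closedcone B" by (simp add: closedcone_def)
qed

lemma facet_scale: "u \<in> facet B a \<Longrightarrow> 0 < c \<Longrightarrow> c *\<^sub>R u \<in> facet B a"
  by (auto simp: facet_def)

lemma closed_closedcone: "closed (closedcone (A::'b::euclidean_space set))"
proof -
  have "closedcone A = (\<Inter>a\<in>A. {u. a \<bullet> u \<ge> 0})" by (auto simp: closedcone_def)
  then show ?thesis by (auto intro!: closed_INT closed_halfspace_ge)
qed

lemma open_opencone: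
  assumes "finite (A::'b::euclidean_space set)"
  shows "open (opencone A)"
proof -
  have "opencone A = (\<Inter>a\<in>A. {u. a \<bullet> u > 0})" by (auto simp: opencone_def)
  then show ?thesis using assms by (auto intro!: open_INT open_halfspace_gt)
qed

lemma tendsto_line: "((\<lambda>t. u + t *\<^sub>R y) \<longlongrightarrow> (u::'b::real_normed_vector)) (at_right (0::real))"
proof -
  have "((\<lambda>t. u + t *\<^sub>R y) \<longlongrightarrow> u + 0 *\<^sub>R y) (at_right (0::real))"
    by (intro tendsto_intros)
  then show ?thesis by simp
qed

text \<open>Carries a closed condition from the perturbed points \<open>u + t y\<close> to
  \<open>u\<close>; boundary points of cones and facets are reached in this way.\<close>

lemma closed_line_limit:
  assumes "closed S" "\<And>t. t > 0 \<Longrightarrow> u + t *\<^sub>R y \<in> S"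
  shows "(u::'b::real_normed_vector) \<in> S"
proof (rule Lim_in_closed_set[OF assms(1) _ trivial_limit_at_right_real tendsto_line])
  show "\<forall>\<^sub>F t in at_right (0::real). u + t *\<^sub>R y \<in> S"
    using eventually_at_right_less by eventually_elim (rule assms(2))
qed

lemma opencone_small_step:
  assumes "finite (A::'b::euclidean_space set)" "u \<in> opencone A"
  obtains \<epsilon> where "\<epsilon> > 0" "u + \<epsilon> *\<^sub>R y \<in> opencone A"
proof -
  have "\<forall>\<^sub>F t in at_right (0::real). u + t *\<^sub>R y \<in> opencone A"
    using topological_tendstoD[OF tendsto_line open_opencone[OF assms(1)] assms(2)] .
  moreover have "\<forall>\<^sub>F t in at_right (0::real). t > 0" by (rule eventually_at_right_less)
  ultimately have "\<forall>\<^sub>F t in at_right (0::real). t > 0 \<and> u + t *\<^sub>R y \<in> opencone A"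
    by eventually_elim simp
  then show thesis using that eventually_happens'[OF trivial_limit_at_right_real] by blast
qed

section \<open>Closures, tangent cones and irredundant systems\<close>

lemma closure_opencone:
  assumes "opencone (A::'b::euclidean_space set) \<noteq> {}"
  shows "closure (opencone A) = closedcone A"
proof
  show "closure (opencone A) \<subseteq> closedcone A"
    by (rule closure_minimal[OF opencone_subset_closedcone closed_closedcone])
  obtain o' where o: "o' \<in> opencone A" using assms by blast
  show "closedcone A \<subseteq> closure (opencone A)"
  proof
    fix u assume u: "u \<in> closedcone A"
    show "u \<in> closure (opencone A)"
    proof (rule closed_line_limit[OF closed_closure])
      fix t :: real assume "0 < t"
      then show "u + t *\<^sub>R o' \<in> closure (opencone A)"
        using closure_subset closedcone_add_opencone[OF u opencone_scale[OF o]] by blast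
    qed
  qed
qed

text \<open>The vector \<open>l x - y\<close> lies in the closed cone exactly when \<open>l\<close>
  bounds every quotient, so the infimum is the largest quotient.\<close>

lemma Mfun_opencone:
  assumes fin: "finite (A::'b::euclidean_space set)" "A \<noteq> {}"
    and x: "x \<in> opencone A" and y: "y \<in> closedcone A"
  shows "Mfun (opencone A) y x = mx A y x"
proof -
  have iff: "l *\<^sub>R x - y \<in> closedcone A \<longleftrightarrow> mx A y x \<le> l" for l
  proof -
    have "a \<bullet> (l *\<^sub>R x - y) \<ge> 0 \<longleftrightarrow> (a \<bullet> y) / (a \<bullet> x) \<le> l" if "a \<in> A" for a
      using x that by (auto simp: opencone_def inner_diff_right pos_divide_le_eq)
    then have "l *\<^sub>R x - y \<in> closedcone A \<longleftrightarrow> (\<forall>a\<in>A. (a \<bullet> y) / (a \<bullet> x) \<le> l)"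
      by (auto simp: closedcone_def)
    also have "\<dots> \<longleftrightarrow> mx A y x \<le> l"
      unfolding mx_def using fin by (subst Max_le_iff) auto
    finally show ?thesis .
  qed
  obtain a where a: "a \<in> A" "mx A y x = (a \<bullet> y) / (a \<bullet> x)" using mx_attained[OF fin] by blast
  have m0: "mx A y x \<ge> 0" using a x y by (auto simp: opencone_def closedcone_def less_imp_le)
  have "Mfun (opencone A) y x = Inf {l. l > 0 \<and> mx A y x \<le> l}"
    using x unfolding Mfun_def by (subst closure_opencone) (auto simp: iff)
  also have "\<dots> = mx A y x"
  proof (cases "mx A y x = 0")
    case True
    then have "{l. l > 0 \<and> mx A y x \<le> l} = {0<..}" by auto
    then show ?thesis using True by simp
  next
    case False
    then have "{l. l > 0 \<and> mx A y x \<le> l} = {mx A y x..}" using m0 by auto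
    then show ?thesis by simp
  qed
  finally show ?thesis .
qed

text \<open>Functionals positive at \<open>z\<close> stay positive for small steps, and those
  vanishing there become positive at once along \<open>u\<close>.\<close>

lemma tangent_step:
  assumes fin: "finite (A::'b::euclidean_space set)" and z: "z \<in> closedcone A"
    and u: "u \<in> opencone (active A z)"
  obtains e where "e > 0" "z + e *\<^sub>R u \<in> opencone A"
proof -
  have "z \<in> opencone (A - active A z)"
    using z by (force simp: opencone_def closedcone_def active_def)
  then obtain e where e: "e > 0" "z + e *\<^sub>R u \<in> opencone (A - active A z)"
    using opencone_small_step[of "A - active A z" z] fin by blast
  have "z + e *\<^sub>R u \<in> opencone A"
    using e u by (force simp: opencone_def active_def inner_add_right)
  with e(1) show thesis by (rule that)
qed

lemma tangent_cone_opencone: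
  assumes fin: "finite (A::'b::euclidean_space set)" and z: "z \<in> closedcone A"
  shows "tangent_cone (opencone A) z = opencone (active A z)"
proof
  show "tangent_cone (opencone A) z \<subseteq> opencone (active A z)"
    by (auto simp: tangent_cone_def opencone_def active_def inner_diff_right)
  show "opencone (active A z) \<subseteq> tangent_cone (opencone A) z"
  proof
    fix u assume u: "u \<in> opencone (active A z)"
    obtain e where e: "e > 0" "z + e *\<^sub>R u \<in> opencone A" using tangent_step[OF fin z u] .
    have "u = (1 / e) *\<^sub>R ((z + e *\<^sub>R u) - z)" using e by simp
    moreover have "1 / e > 0" using e(1) by simp
    ultimately show "u \<in> tangent_cone (opencone A) z"
      unfolding tangent_cone_def using e(2) by blast
  qed
qed

text \<open>Functionals with an empty facet are removed one at a time, which leaves the open cone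
  unchanged.\<close>

lemma irredundant_subset:
  assumes "finite (A::'b::real_inner set)" "opencone A \<noteq> {}"
  shows "\<exists>A'\<subseteq>A. irredundant A' \<and> opencone A' = opencone A"
  using assms
proof (induction "card A" arbitrary: A rule: less_induct)
  case less
  show ?case
  proof (cases "irredundant A")
    case False
    then obtain a where a: "a \<in> A" "facet A a = {}" by (auto simp: irredundant_def)
    obtain o' where o: "o' \<in> opencone A" using less.prems by blast
    \<comment> \<open>If \<open>a\<close> were nonpositive at \<open>q\<close>, the segment from
      \<open>o'\<close> to \<open>q\<close> would meet the hyperplane of \<open>a\<close> where all
      other functionals are positive, in a point of the empty facet.\<close>
    have "q \<in> opencone A" if q: "q \<in> opencone (A - {a})" for q
    proof (rule ccontr)
      assume "q \<notin> opencone A"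
      then have "a \<bullet> q \<le> 0" using q by (fastforce simp: opencone_def)
      moreover have "0 < (a \<bullet> o') * (b \<bullet> q)" "0 < b \<bullet> o'" if "b \<in> A - {a}" for b
        using o q a(1) that by (auto simp: opencone_def)
      ultimately have "0 < b \<bullet> ((a \<bullet> o') *\<^sub>R q - (a \<bullet> q) *\<^sub>R o')" if "b \<in> A - {a}" for b
        using that mult_nonpos_nonneg[of "a \<bullet> q" "b \<bullet> o'"]
        by (smt (verit) inner_diff_right inner_scaleR_right)
      then have "(a \<bullet> o') *\<^sub>R q - (a \<bullet> q) *\<^sub>R o' \<in> facet A a"
        by (auto simp: facet_def inner_diff_right)
      then show False using a by blast
    qed
    then have eq: "opencone (A - {a}) = opencone A" by (auto simp: opencone_def)
    have "\<exists>A'\<subseteq>A - {a}. irredundant A' \<and> opencone A' = opencone (A - {a})"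
      using less.prems a(1) eq by (intro less.hyps card_Diff1_less) auto
    then show ?thesis using eq by blast
  qed blast
qed

section \<open>Inequalities between gauges\<close>

lemma opencone_active: "opencone A \<subseteq> opencone (active A z)"
  by (auto simp: opencone_def active_def)

lemma mx_self: "finite A \<Longrightarrow> A \<noteq> {} \<Longrightarrow> x \<in> opencone A \<Longrightarrow> mx A x x = 1"
  using mx_attained[of A x x] by (fastforce simp: opencone_def)

lemma mx_trans:
  assumes fin: "finite A" "A \<noteq> {}"
    and mem: "x \<in> opencone A" "y \<in> opencone A" "z \<in> opencone A"
  shows "mx A x z \<le> mx A x y * mx A y z"
proof (rule mx_le[OF fin])
  fix a assume a: "a \<in> A"
  have pos: "0 < a \<bullet> x" "0 < a \<bullet> y" "0 < a \<bullet> z" using a mem by (auto simp: opencone_def)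
  have "a \<bullet> x / (a \<bullet> z) = (a \<bullet> x / (a \<bullet> y)) * (a \<bullet> y / (a \<bullet> z))" using pos by simp
  also have "\<dots> \<le> mx A x y * mx A y z"
    using pos mx_pos_opencone[OF fin mem(2,1)]
    by (intro mult_mono mx_ge[OF fin(1) a]) auto
  finally show "a \<bullet> x / (a \<bullet> z) \<le> mx A x y * mx A y z" .
qed

text \<open>The middle point is on the boundary of the cone, so \<open>mx_trans\<close> does not
  apply; the term of \<open>a\<close> is no obstacle, because \<open>a\<close> vanishes at
  \<open>x\<close> as well.\<close>

lemma mx_facet_trans:
  assumes fin: "finite B" "a \<in> B"
    and mem: "x \<in> facet B a" "x' \<in> facet B a" and u: "u \<in> opencone B"
  shows "mx B x u \<le> mx B x x' * mx B x' u"
proof (rule mx_le[OF fin(1)])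
  have nonneg: "0 \<le> mx B x x'" "0 \<le> mx B x' u"
    using mx_ge[OF fin, of x x'] mx_ge[OF fin, of x' u] mem by (auto simp: facet_def)
  fix b assume b: "b \<in> B"
  show "b \<bullet> x / (b \<bullet> u) \<le> mx B x x' * mx B x' u"
  proof (cases "b = a")
    case True
    then show ?thesis using nonneg mem by (simp add: facet_def)
  next
    case False
    then have pos: "0 < b \<bullet> x" "0 < b \<bullet> x'" "0 < b \<bullet> u"
      using b mem u by (auto simp: opencone_def facet_def)
    have "b \<bullet> x / (b \<bullet> u) = (b \<bullet> x / (b \<bullet> x')) * (b \<bullet> x' / (b \<bullet> u))" using pos by simp
    also have "\<dots> \<le> mx B x x' * mx B x' u"
      using pos nonneg by (intro mult_mono mx_ge[OF fin(1) b]) auto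
    finally show ?thesis .
  qed
qed (use fin in auto)

lemma mx_le_1:
  assumes "finite B" "B \<noteq> {}" "u \<in> opencone B" "u - x \<in> closedcone B"
  shows "mx B x u \<le> 1"
  using assms by (intro mx_le) (auto simp: opencone_def closedcone_def inner_diff_right)

section \<open>Limits of maxima, and apexes of pyramidal facets\<close>

lemma tendsto_Max:
  fixes f :: "'i \<Rightarrow> 'c \<Rightarrow> real"
  assumes "finite I" "I \<noteq> {}" "\<And>i. i \<in> I \<Longrightarrow> (f i \<longlongrightarrow> l i) F"
  shows "((\<lambda>n. Max ((\<lambda>i. f i n) ` I)) \<longlongrightarrow> Max (l ` I)) F"
  using assms
proof (induction rule: finite_ne_induct)
  case (insert i I)
  then show ?case by (auto intro!: tendsto_max)
qed auto

text \<open>The apex exists because a minimal element of the finite set \<open>V\<close> stays the only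
  candidate along each segment that leaves it.\<close>

lemma cone_apex:
  fixes B :: "'b::euclidean_space set"
  assumes proper: "\<And>u. u \<in> closedcone B \<Longrightarrow> norm u \<le> \<kappa> * (e \<bullet> u)"
    and V: "finite V" "V \<subseteq> closedcone B" "\<And>w. w \<in> V \<Longrightarrow> 1 \<le> l \<bullet> w"
    and nonneg: "\<And>x. x \<in> closedcone B \<Longrightarrow> 0 \<le> l \<bullet> x"
    and cover: "\<And>x. x \<in> closedcone B \<Longrightarrow> \<exists>w\<in>V. x - (l \<bullet> x) *\<^sub>R w \<in> closedcone B"
  obtains w where "w \<in> closedcone B" "l \<bullet> w = 1"
    "\<And>x. x \<in> closedcone B \<Longrightarrow> x - (l \<bullet> x) *\<^sub>R w \<in> closedcone B"
proof -
  define V1 where "V1 = {w \<in> V. l \<bullet> w = 1}"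
  have V1I: "w \<in> V1" if "x \<in> closedcone B" "l \<bullet> x > 0" "w \<in> V" "x - (l \<bullet> x) *\<^sub>R w \<in> closedcone B" for x w
  proof -
    have "(l \<bullet> x) * (l \<bullet> w) \<le> l \<bullet> x" using nonneg[OF that(4)] by (simp add: inner_diff_right)
    then have "l \<bullet> w \<le> 1" using that(2) by simp
    with V(3)[OF that(3)] that(3) show ?thesis by (auto simp: V1_def)
  qed
  obtain w1 where w1: "w1 \<in> V" using cover[of 0] by (auto simp: closedcone_def)
  have "V1 \<noteq> {}"
    using cover[of w1] V1I[of w1] w1 V by fastforce
  then obtain w0 where w0: "w0 \<in> V1" and min: "\<And>w. w \<in> V1 \<Longrightarrow> \<kappa> * (e \<bullet> w0) \<le> \<kappa> * (e \<bullet> w)"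
    using ex_min_if_finite[of "(\<lambda>w. \<kappa> * (e \<bullet> w)) ` V1"] V(1)
    by (force simp: V1_def not_less)
  have w0': "w0 \<in> V" "w0 \<in> closedcone B" "l \<bullet> w0 = 1" using w0 V by (auto simp: V1_def)
  have "y - (l \<bullet> y) *\<^sub>R w0 \<in> closedcone B" if y: "y \<in> closedcone B" for y
  proof (rule ccontr)
    assume contr: "y - (l \<bullet> y) *\<^sub>R w0 \<notin> closedcone B"
    \<comment> \<open>\<open>S\<close> holds the points served by a candidate other than
      \<open>w0\<close>. At \<open>w0 + t y\<close> the candidate \<open>w0\<close> fails, since the
      remainder is \<open>t (y - (l \<bullet> y) w0)\<close>; as \<open>S\<close> is closed, another
      candidate serves \<open>w0\<close> itself.\<close>
    define S where "S = (\<Union>w\<in>V - {w0}. {z. z - (l \<bullet> z) *\<^sub>R w \<in> closedcone B})"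
    have "closed {z. z - (l \<bullet> z) *\<^sub>R w \<in> closedcone B}" for w
      using closed_vimage[OF closed_closedcone[of B], of "\<lambda>z. z - (l \<bullet> z) *\<^sub>R w"]
      by (simp add: vimage_def continuous_intros)
    then have "closed S" using V(1) by (auto simp: S_def)
    then have "w0 \<in> S"
    proof (rule closed_line_limit)
      fix t :: real assume t: "t > 0"
      have "w0 + t *\<^sub>R y \<in> closedcone B"
        using t y w0' by (intro closedcone_add closedcone_scale) auto
      from cover[OF this] obtain w where w: "w \<in> V"
        "w0 + t *\<^sub>R y - (l \<bullet> (w0 + t *\<^sub>R y)) *\<^sub>R w \<in> closedcone B" by blast
      have "w \<noteq> w0"
      proof
        assume "w = w0"
        then have "t *\<^sub>R (y - (l \<bullet> y) *\<^sub>R w0) \<in> closedcone B"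
          using w(2) w0' by (simp add: inner_add_right algebra_simps)
        then have "(1 / t) *\<^sub>R (t *\<^sub>R (y - (l \<bullet> y) *\<^sub>R w0)) \<in> closedcone B"
          by (rule closedcone_scale) (use t in auto)
        with t contr show False by simp
      qed
      with w show "w0 + t *\<^sub>R y \<in> S" by (auto simp: S_def)
    qed
    then obtain w where w: "w \<in> V" "w \<noteq> w0" "w0 - w \<in> closedcone B"
      using w0' by (auto simp: S_def)
    \<comment> \<open>By minimality of \<open>w0\<close>,
      \<open>\<kappa> * (e \<bullet> (w0 - w))\<close> is at most \<open>0\<close>, and properness
      forces \<open>w = w0\<close>.\<close>
    have "w \<in> V1" using V1I[of w0 w] w w0' by simp
    then have "norm (w0 - w) \<le> 0"
      using proper[OF w(3)] min[of w] unfolding inner_diff_right right_diff_distrib by linarith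
    with w(2) show False by simp
  qed
  with w0' show thesis by (intro that[of w0])
qed

text \<open>Adding \<open>- a\<close> turns the closed facet of \<open>a\<close> into a closed cone
  of the same form, to which \<open>cone_apex\<close> applies.\<close>

lemma closedcone_insert_uminus:
  "a \<in> B \<Longrightarrow> x \<in> closedcone (insert (- a) B) \<longleftrightarrow> x \<in> closedcone B \<and> a \<bullet> x = 0"
  by (auto simp: closedcone_def intro: antisym)

lemma facet_step:
  assumes "finite (B::'b::euclidean_space set)" "x \<in> facet B a" "a \<bullet> y = 0"
  obtains \<epsilon> where "\<epsilon> > 0" "x + \<epsilon> *\<^sub>R y \<in> facet B a"
proof -
  have "x \<in> opencone (B - {a})" using assms by (auto simp: opencone_def facet_def)
  then obtain e where "e > 0" "x + e *\<^sub>R y \<in> opencone (B - {a})"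
    using opencone_small_step[of "B - {a}" x] assms by blast
  then show thesis
    using assms by (intro that[of e]) (auto simp: opencone_def facet_def inner_add_right)
qed

lemma norm_bound_antisym:
  assumes "norm u \<le> \<kappa> * (e \<bullet> u)" "norm (- u) \<le> \<kappa> * (e \<bullet> - u)"
  shows "u = (0::'b::real_inner)"
proof -
  have "norm u \<le> - (\<kappa> * (e \<bullet> u))" using assms(2) by simp
  then have "norm u \<le> 0" using assms(1) by linarith
  then show ?thesis by simp
qed

text \<open>The bound \<open>proper\<close> excludes lines and makes slices of bounded height
  \<open>e\<close> bounded. In the application \<open>e\<close> is the last coordinate and
  \<open>\<kappa>\<close> comes from the boundedness of \<open>Y\<close>.\<close>

locale proper_cone =
  fixes B :: "'b::euclidean_space set" and e :: 'b and \<kappa> :: real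
  assumes finB: "finite B" and neB: "opencone B \<noteq> {}" and irrB: "irredundant B"
    and proper: "\<And>u. u \<in> closedcone B \<Longrightarrow> norm u \<le> \<kappa> * (e \<bullet> u)"
begin

lemma pointed: "u \<in> closedcone B \<Longrightarrow> - u \<in> closedcone B \<Longrightarrow> u = 0"
  by (rule norm_bound_antisym[OF proper proper])

text \<open>The closed facet of \<open>a\<close> is a pyramid with apex ray through \<open>w\<close>
  over its intersection with the facet of \<open>b\<close>: subtracting the multiple of
  \<open>w\<close> that makes \<open>b\<close> vanish does not leave the cone.\<close>

definition apex :: "'b \<Rightarrow> 'b \<Rightarrow> 'b \<Rightarrow> bool" where
  "apex a b w \<longleftrightarrow> w \<in> closedcone B \<and> a \<bullet> w = 0 \<and> b \<bullet> w = 1 \<and>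
     (\<forall>x\<in>closedcone B. a \<bullet> x = 0 \<longrightarrow> x - (b \<bullet> x) *\<^sub>R w \<in> closedcone B)"

text \<open>A facet that is a pyramid with apex \<open>w'\<close> over its face in \<open>b\<close> and with apex \<open>w''\<close> over its
  face in \<open>c\<close> has distinct apexes, since otherwise \<open>b\<close> and \<open>c\<close> would be proportional on it.\<close>

lemma apex_orthogonal:
  assumes B: "a \<in> B" "b \<in> B" "c \<in> B" and dist: "a \<noteq> b" "a \<noteq> c" "b \<noteq> c"
    and w': "apex a b w'" and w'': "apex a c w''"
  shows "b \<bullet> w'' = 0"
proof (rule ccontr)
  assume t0: "b \<bullet> w'' \<noteq> 0"
  define t where "t = b \<bullet> w''"
  define s where "s = c \<bullet> w'"
  have t: "t > 0" using t0 w'' B by (auto simp: apex_def t_def closedcone_def less_le)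
  have diff: "w'' - t *\<^sub>R w' \<in> closedcone B"
    using w' w'' by (auto simp: apex_def t_def)
  \<comment> \<open>Projecting \<open>w''\<close> along \<open>w'\<close> and the result along
    \<open>w''\<close> leaves \<open>t (s w'' - w')\<close>. The projection of \<open>w'\<close>
    along \<open>w''\<close> supplies the opposite sign, so pointedness gives
    \<open>w' = s w''\<close>.\<close>
  have "w'' - t *\<^sub>R w' - (c \<bullet> (w'' - t *\<^sub>R w')) *\<^sub>R w'' \<in> closedcone B"
  proof -
    have "a \<bullet> (w'' - t *\<^sub>R w') = 0" using w' w'' by (simp add: apex_def inner_diff_right)
    with diff w'' show ?thesis by (auto simp: apex_def simp del: inner_diff_right)
  qed
  moreover have "w'' - t *\<^sub>R w' - (c \<bullet> (w'' - t *\<^sub>R w')) *\<^sub>R w'' = t *\<^sub>R (s *\<^sub>R w'' - w')"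
    using w'' by (simp add: apex_def inner_diff_right s_def algebra_simps)
  ultimately have "(1 / t) *\<^sub>R (t *\<^sub>R (s *\<^sub>R w'' - w')) \<in> closedcone B"
    using t by (metis closedcone_scale less_imp_le zero_less_divide_1_iff)
  then have "s *\<^sub>R w'' - w' \<in> closedcone B" using t by simp
  moreover have "w' - s *\<^sub>R w'' \<in> closedcone B"
    using w' w'' by (auto simp: apex_def s_def)
  ultimately have eq: "w' = s *\<^sub>R w''"
    using pointed[of "s *\<^sub>R w'' - w'"] by simp
  then have st: "s * t = 1" using w' by (simp add: apex_def t_def)
  have proportional: "c \<bullet> x = s * (b \<bullet> x)" if x: "x \<in> closedcone B" "a \<bullet> x = 0" for x
  proof -
    have "x - (b \<bullet> x) *\<^sub>R w' \<in> closedcone B" "x - (c \<bullet> x) *\<^sub>R w'' \<in> closedcone B"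
      using x w' w'' by (auto simp: apex_def)
    then have "0 \<le> c \<bullet> (x - (b \<bullet> x) *\<^sub>R w')" "0 \<le> b \<bullet> (x - (c \<bullet> x) *\<^sub>R w'')"
      using B by (auto simp: closedcone_def)
    then have 1: "s * (b \<bullet> x) \<le> c \<bullet> x" and 2: "t * (c \<bullet> x) \<le> b \<bullet> x"
      by (auto simp: inner_diff_right s_def t_def algebra_simps)
    have s: "s > 0" using st t by (smt (verit) mult_nonpos_nonneg)
    have "c \<bullet> x = s * (t * (c \<bullet> x))" using st by (simp flip: mult.assoc)
    also have "\<dots> \<le> s * (b \<bullet> x)" using 2 s by simp
    finally show ?thesis using 1 by simp
  qed
  obtain x0 x' x'' where x: "x0 \<in> facet B a" "x' \<in> facet B b" "x'' \<in> facet B c"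
    using irrB B by (fastforce simp: irredundant_def)
  \<comment> \<open>\<open>y\<close> is a direction along the facet of \<open>a\<close> with
    \<open>c \<bullet> y > 0 > b \<bullet> y\<close>. Proportionality of \<open>b\<close> and
    \<open>c\<close> on the facet passes to such directions, and with \<open>s > 0\<close> it is
    violated.\<close>
  define y where "y = (a \<bullet> x'') *\<^sub>R x' - (a \<bullet> x') *\<^sub>R x''"
  have "a \<bullet> y = 0" by (simp add: y_def inner_diff_right)
  then obtain \<epsilon> where \<epsilon>: "\<epsilon> > 0" "x0 + \<epsilon> *\<^sub>R y \<in> facet B a"
    using facet_step[OF finB x(1)] by blast
  have "c \<bullet> (x0 + \<epsilon> *\<^sub>R y) = s * (b \<bullet> (x0 + \<epsilon> *\<^sub>R y))" "c \<bullet> x0 = s * (b \<bullet> x0)"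
    using x(1) \<epsilon>(2) facet_subset_closedcone[of B a] by (auto intro!: proportional simp: facet_def)
  then have "c \<bullet> y = s * (b \<bullet> y)" using \<epsilon>(1) by (simp add: inner_add_right distrib_left)
  moreover have "c \<bullet> y > 0" "b \<bullet> y < 0"
    using x B dist by (auto simp: y_def inner_diff_right facet_def)
  moreover have "s > 0" using st t by (smt (verit) mult_nonpos_nonneg)
  ultimately show False by (smt (verit) mult_pos_neg)
qed

end

section \<open>The correspondence between vertex parts and facet parts\<close>

text \<open>\<open>W\<close> is instantiated with all pairs of positive multiples of
  \<open>lift w\<close> and \<open>lift (g w)\<close>, so it relates the rays matched by the
  isometry.\<close>

locale cone_correspondence = proper_cone B e \<kappa>
  for B :: "'b::euclidean_space set" and e :: 'b and \<kappa> :: real +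
  fixes A :: "'b set" and W :: "('b \<times> 'b) set"
  assumes finA: "finite A" and neA: "opencone A \<noteq> {}" and irrA: "irredundant A"
    and W_subset: "W \<subseteq> opencone A \<times> opencone B"
    and W_left: "\<And>u. u \<in> opencone A \<Longrightarrow> \<exists>u'. (u, u') \<in> W"
    and W_right: "\<And>u'. u' \<in> opencone B \<Longrightarrow> \<exists>u. (u, u') \<in> W"
begin

text \<open>The exponentials of the horofunctions attached to \<open>(v, p)\<close> in the vertex part of \<open>v\<close> and
  to \<open>x\<close> in the facet part of \<open>a\<close> agree along \<open>W\<close>.\<close>

definition corr :: "'b \<Rightarrow> 'b \<Rightarrow> 'b \<Rightarrow> 'b \<Rightarrow> bool" where
  "corr v a p x \<longleftrightarrow> p \<in> opencone (active A v) \<and> x \<in> facet B a \<and>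
     (\<forall>(u, u')\<in>W. mx A v u * mx (active A v) u p = (a \<bullet> u') * mx B x u')"

text \<open>The last two conjuncts express that the induced map takes the vertex part of
  \<open>v\<close> onto the facet part of \<open>a\<close>. A functional positive at
  \<open>v\<close> makes \<open>mx A v u\<close> positive, so that it can be cancelled.\<close>

definition vertex_to_facet :: "'b \<Rightarrow> 'b \<Rightarrow> bool" where
  "vertex_to_facet v a \<longleftrightarrow> v \<in> closedcone A \<and> active A v \<noteq> {} \<and> (\<exists>i\<in>A. i \<bullet> v > 0) \<and> a \<in> B \<and>
     (\<forall>p\<in>opencone (active A v). \<exists>x. corr v a p x) \<and> (\<forall>x\<in>facet B a. \<exists>p. corr v a p x)"

lemma fin_active: "finite (active A v)" using finA by (simp add: active_def)

text \<open>Dividing the identities of the two pairs cancels the factors of \<open>v\<close> and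
  \<open>a\<close>, so the suprema over \<open>W\<close> of
  \<open>mx (active A v) u p / mx (active A v) u p'\<close> and of
  \<open>mx B x u' / mx B x' u'\<close> agree. By the triangle inequality they are the two
  sides.\<close>

lemma corr_dual:
  assumes va: "vertex_to_facet v a" and c: "corr v a p x" and c': "corr v a p' x'"
  shows "mx (active A v) p' p = mx B x x'"
proof (rule antisym)
  let ?A = "active A v"
  have neV: "?A \<noteq> {}" and aB: "a \<in> B" and vA: "v \<in> closedcone A"
    using va by (auto simp: vertex_to_facet_def)
  have neB': "B \<noteq> {}" using aB by auto
  have p: "p \<in> opencone ?A" "p' \<in> opencone ?A" and x: "x \<in> facet B a" "x' \<in> facet B a"
    using c c' by (auto simp: corr_def)
  have x'B: "x' \<in> closedcone B" using x facet_subset_closedcone by blast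
  have cross: "mx ?A u p * mx B x' u' = mx ?A u p' * mx B x u'" and mem: "u \<in> opencone A"
    "u' \<in> opencone B" and pos: "mx ?A u p' > 0" "mx B x' u' > 0" if W: "(u, u') \<in> W" for u u'
  proof -
    show u: "u \<in> opencone A" "u' \<in> opencone B" using W W_subset by auto
    obtain i where "i \<in> A" "i \<bullet> v > 0" using va by (auto simp: vertex_to_facet_def)
    then have m: "mx A v u > 0" using mx_pos[OF finA u(1)] by blast
    have au: "a \<bullet> u' > 0" using u aB by (auto simp: opencone_def)
    have 1: "mx A v u * mx ?A u p = (a \<bullet> u') * mx B x u'"
      "mx A v u * mx ?A u p' = (a \<bullet> u') * mx B x' u'"
      using c c' W by (auto simp: corr_def)
    have "(mx A v u * mx ?A u p) * ((a \<bullet> u') * mx B x' u') =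
        (mx A v u * mx ?A u p') * ((a \<bullet> u') * mx B x u')" unfolding 1 by simp
    then show "mx ?A u p * mx B x' u' = mx ?A u p' * mx B x u'" using m au by simp
    show mp: "mx ?A u p' > 0"
      using u p opencone_active by (intro mx_pos_opencone fin_active neV) auto
    have "0 < mx A v u * mx ?A u p'" using m mp by simp
    then show "mx B x' u' > 0" using 1 au by (simp add: zero_less_mult_iff)
  qed
  show "mx ?A p' p \<le> mx B x x'"
  proof -
    \<comment> \<open>The functionals active at \<open>v\<close> see only
      \<open>\<epsilon> p'\<close> here, so this point attains the first supremum.\<close>
    obtain \<epsilon> where \<epsilon>: "\<epsilon> > 0" "v + \<epsilon> *\<^sub>R p' \<in> opencone A"
      using tangent_step[OF finA vA p(2)] .
    obtain u' where W: "(v + \<epsilon> *\<^sub>R p', u') \<in> W" using W_left \<epsilon> by blast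
    have "mx ?A (v + \<epsilon> *\<^sub>R p') q = mx ?A (\<epsilon> *\<^sub>R p') q" for q
      unfolding mx_def by (intro arg_cong[where f=Max] image_cong) (auto simp: active_def inner_add_right)
    then have "\<epsilon> * mx ?A p' p * mx B x' u' = \<epsilon> * mx ?A p' p' * mx B x u'"
      using cross[OF W] \<epsilon> by (simp add: mx_scale_left fin_active neV)
    then have "mx ?A p' p * mx B x' u' = mx B x u'"
      using \<epsilon>(1) mx_self[OF fin_active neV p(2)] by simp
    also have "\<dots> \<le> mx B x x' * mx B x' u'"
      by (rule mx_facet_trans[OF finB aB x mem(2)[OF W]])
    finally show ?thesis using pos(2)[OF W] by simp
  qed
  show "mx B x x' \<le> mx ?A p' p"
  proof (rule mx_le[OF finB neB'])
    fix b assume b: "b \<in> B"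
    have m: "mx ?A p' p > 0" by (rule mx_pos_opencone[OF fin_active neV p])
    show "b \<bullet> x / (b \<bullet> x') \<le> mx ?A p' p"
    proof (cases "b = a")
      case True
      then show ?thesis using m x by (simp add: facet_def)
    next
      case False
      obtain o' where o: "o' \<in> opencone B" using neB by blast
      \<comment> \<open>The second supremum is approached as \<open>u'\<close> tends to
        \<open>x'\<close>; along the chosen \<open>u'\<close> the gauge \<open>mx B x' u'\<close> is
        at most \<open>1\<close>.\<close>
      have "x' \<in> {y. b \<bullet> x \<le> mx ?A p' p * (b \<bullet> y)}"
      proof (rule closed_line_limit)
        show "closed {y. b \<bullet> x \<le> mx ?A p' p * (b \<bullet> y)}"
          by (intro closed_Collect_le continuous_intros)
        fix t :: real assume t: "t > 0"
        define u' where "u' = x' + t *\<^sub>R o'"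
        have u': "u' \<in> opencone B" unfolding u'_def
          by (intro closedcone_add_opencone[OF x'B] opencone_scale[OF o t])
        obtain u where W: "(u, u') \<in> W" using W_right[OF u'] by blast
        have "u' - x' \<in> closedcone B"
          using opencone_scale[OF o t] opencone_subset_closedcone by (auto simp: u'_def)
        then have "mx B x' u' \<le> 1" by (rule mx_le_1[OF finB neB' u'])
        moreover have mp: "mx ?A u p > 0"
          using mem(1)[OF W] p opencone_active by (intro mx_pos_opencone fin_active neV) auto
        ultimately have "mx ?A u p' * mx B x u' \<le> mx ?A u p"
          using cross[OF W] by (metis less_imp_le mult.right_neutral mult_left_mono)
        also have "\<dots> \<le> mx ?A u p' * mx ?A p' p"
          using mem(1)[OF W] opencone_active by (intro mx_trans fin_active neV p) auto
        finally have "mx B x u' \<le> mx ?A p' p" using pos(1)[OF W] by simp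
        then have "b \<bullet> x / (b \<bullet> u') \<le> mx ?A p' p"
          using mx_ge[OF finB b, of x u'] by linarith
        then show "x' + t *\<^sub>R o' \<in> {y. b \<bullet> x \<le> mx ?A p' p * (b \<bullet> y)}"
          using u' b by (auto simp: opencone_def u'_def[symmetric] pos_divide_le_eq)
      qed
      moreover have "b \<bullet> x' > 0" using x b False by (auto simp: facet_def)
      ultimately show ?thesis by (simp add: pos_divide_le_eq)
    qed
  qed
qed

definition separated :: "'b \<Rightarrow> 'b \<Rightarrow> bool" where
  "separated v v' \<longleftrightarrow> (\<exists>i\<in>active A v. i \<bullet> v' > 0)"

text \<open>Both sides are the infimum of the product of the two functions attached to \<open>p, p'\<close>
  (respectively to \<open>x, x'\<close>); it is approached along the segment from \<open>v\<close> to \<open>v'\<close>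
  (respectively from \<open>x\<close> to \<open>x'\<close>).\<close>

lemma gromov_product:
  assumes va: "vertex_to_facet v a" and va': "vertex_to_facet v' a'"
    and sep: "separated v v'" "separated v' v"
    and c: "corr v a p x" and c': "corr v' a' p' x'"
  shows "a \<noteq> a'" "mx (active A v) v' p * mx (active A v') v p' = (a' \<bullet> x) * (a \<bullet> x')"
proof -
  let ?A = "active A v" and ?A' = "active A v'"
  let ?P = "mx ?A v' p * mx ?A' v p'"
  have neV: "?A \<noteq> {}" "?A' \<noteq> {}" and aB: "a \<in> B" "a' \<in> B" and vA: "v \<in> closedcone A" "v' \<in> closedcone A"
    using va va' by (auto simp: vertex_to_facet_def)
  have neB': "B \<noteq> {}" and neA': "A \<noteq> {}" using aB neV by (auto simp: active_def)
  have p: "p \<in> opencone ?A" "p' \<in> opencone ?A'" and x: "x \<in> facet B a" "x' \<in> facet B a'"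
    using c c' by (auto simp: corr_def)
  have xB: "x \<in> closedcone B" "x' \<in> closedcone B" using x facet_subset_closedcone by blast+
  obtain oA oB where oA: "oA \<in> opencone A" and oB: "oB \<in> opencone B" using neA neB by blast
  have oA': "oA \<in> opencone ?A" "oA \<in> opencone ?A'" using oA opencone_active by auto
  obtain i0 where "i0 \<in> ?A" "i0 \<bullet> v' > 0" using sep by (auto simp: separated_def)
  then have m: "mx ?A v' p > 0" by (intro mx_pos[OF fin_active p(1)])
  obtain j0 where "j0 \<in> ?A'" "j0 \<bullet> v > 0" using sep by (auto simp: separated_def)
  then have m': "mx ?A' v p' > 0" by (intro mx_pos[OF fin_active p(2)])
  obtain i where i: "i \<in> ?A" "mx ?A v' p = (i \<bullet> v') / (i \<bullet> p)" using mx_attained[OF fin_active neV(1)] by blast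
  obtain j where j: "j \<in> ?A'" "mx ?A' v p' = (j \<bullet> v) / (j \<bullet> p')" using mx_attained[OF fin_active neV(2)] by blast
  have pos: "i \<bullet> p > 0" "j \<bullet> p' > 0" using i j p by (auto simp: opencone_def)
  then have pos': "i \<bullet> v' > 0" "j \<bullet> v > 0" using m m' i j by (auto simp: zero_less_divide_iff)
  define \<Xi> where "\<Xi> = (\<lambda>u. (mx A v u * mx ?A u p) * (mx A v' u * mx ?A' u p'))"
  define H where "H = (\<lambda>u'. ((a \<bullet> u') * mx B x u') * ((a' \<bullet> u') * mx B x' u'))"
  have \<Xi>H: "\<Xi> u = H u'" if "(u, u') \<in> W" for u u'
    using that c c' by (fastforce simp: \<Xi>_def H_def corr_def)
  \<comment> \<open>The functionals \<open>i\<close> and \<open>j\<close> that attain the gauges in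
    \<open>?P\<close> bound each factor from below, and their values at \<open>u\<close>
    cancel.\<close>
  have low: "?P \<le> H u'" if u': "u' \<in> opencone B" for u'
  proof -
    obtain u where W: "(u, u') \<in> W" using W_right[OF u'] by blast
    then have u: "u \<in> opencone A" using W_subset by auto
    have iA: "i \<in> A" "j \<in> A" using i j by (auto simp: active_def)
    have u0: "i \<bullet> u > 0" "j \<bullet> u > 0" using u iA by (auto simp: opencone_def)
    have "?P = ((j \<bullet> v / (j \<bullet> u)) * (i \<bullet> u / (i \<bullet> p))) * ((i \<bullet> v' / (i \<bullet> u)) * (j \<bullet> u / (j \<bullet> p')))"
      using i j u0 by simp
    also have "\<dots> \<le> \<Xi> u"
      unfolding \<Xi>_def
    proof (intro mult_mono)
      show "j \<bullet> v / (j \<bullet> u) \<le> mx A v u" "i \<bullet> v' / (i \<bullet> u) \<le> mx A v' u"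
        using iA by (auto intro: mx_ge finA)
      show "i \<bullet> u / (i \<bullet> p) \<le> mx ?A u p" "j \<bullet> u / (j \<bullet> p') \<le> mx ?A' u p'"
        using i j by (auto intro: mx_ge fin_active)
      have "mx A v u > 0" "mx A v' u > 0" using mx_pos[OF finA u] iA pos' by auto
      moreover have "mx ?A u p > 0" "mx ?A' u p' > 0"
        using u opencone_active by (auto intro!: mx_pos_opencone fin_active neV p)
      ultimately show "0 \<le> mx A v u" "0 \<le> mx A v' u" "0 \<le> mx A v u * mx ?A u p" by auto
    qed (use pos pos' u0 in auto)
    finally show ?thesis using \<Xi>H[OF W] by simp
  qed
  \<comment> \<open>If \<open>a = a'\<close>, this functional vanishes at \<open>x + x'\<close>, so
    \<open>H\<close> is of order \<open>t^2\<close> near that point, against the positive lower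
    bound \<open>?P\<close>.\<close>
  show aa': "a \<noteq> a'"
  proof
    assume eq: "a = a'"
    have "?P \<le> 0 * 0"
    proof (rule tendsto_lowerbound[OF _ _ trivial_limit_at_right_real])
      show "((\<lambda>t. (t * (a \<bullet> oB)) * (t * (a \<bullet> oB))) \<longlongrightarrow> 0 * 0) (at_right 0)"
        by (auto intro!: tendsto_eq_intros)
      show "\<forall>\<^sub>F t in at_right 0. ?P \<le> (t * (a \<bullet> oB)) * (t * (a \<bullet> oB))"
        using eventually_at_right_less[of "0::real"]
      proof eventually_elim
        case (elim t)
        define u' where "u' = (x + x') + t *\<^sub>R oB"
        have u': "u' \<in> opencone B" unfolding u'_def
          by (intro closedcone_add_opencone closedcone_add xB opencone_scale[OF oB elim])
        have tB: "t *\<^sub>R oB \<in> closedcone B" using oB elim opencone_subset_closedcone closedcone_scale by fastforce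
        have "u' - x \<in> closedcone B" "u' - x' \<in> closedcone B"
          using closedcone_add[OF xB(1) tB] closedcone_add[OF xB(2) tB] by (auto simp: u'_def algebra_simps)
        then have le1: "mx B x u' \<le> 1" "mx B x' u' \<le> 1" using mx_le_1[OF finB neB' u'] by auto
        have ge0: "0 \<le> mx B x u'" "0 \<le> mx B x' u'"
          using mx_ge[OF finB aB(1), of x u'] mx_ge[OF finB aB(1), of x' u'] x eq by (auto simp: facet_def)
        have au: "a \<bullet> u' = t * (a \<bullet> oB)" "0 \<le> a \<bullet> u'"
          using x eq aB u' by (auto simp: u'_def facet_def inner_add_right opencone_def less_imp_le)
        have "?P \<le> H u'" by (rule low[OF u'])
        also have "\<dots> \<le> ((a \<bullet> u') * 1) * ((a \<bullet> u') * 1)"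
          unfolding H_def eq[symmetric] using le1 ge0 au by (intro mult_mono) auto
        finally show ?case using au by simp
      qed
    qed
    moreover have "?P > 0" using m m' by simp
    ultimately show False by simp
  qed
  show "?P = (a' \<bullet> x) * (a \<bullet> x')"
  proof (rule antisym)
    have pr: "a' \<bullet> x > 0" "a \<bullet> x' > 0" using x aB aa' by (auto simp: facet_def)
    have ax: "a \<bullet> x = 0" "a' \<bullet> x' = 0" using x by (auto simp: facet_def)
    \<comment> \<open>For \<open>a \<noteq> a'\<close> the point \<open>x + x'\<close> is interior
      and both gauges there are at most \<open>1\<close>, so \<open>H\<close> is bounded by the
      product sought.\<close>
    have u': "x + x' \<in> opencone B"
      unfolding opencone_def
    proof safe
      fix b assume "b \<in> B"
      then show "0 < b \<bullet> (x + x')"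
        using x pr ax by (cases "b = a"; cases "b = a'") (auto simp: facet_def inner_add_right intro!: add_pos_pos)
    qed
    have le1: "mx B x (x + x') \<le> 1" "mx B x' (x + x') \<le> 1"
      using mx_le_1[OF finB neB' u'] xB by auto
    have ge0: "0 \<le> mx B x (x + x')" "0 \<le> mx B x' (x + x')"
      using mx_pos[OF finB u' aB(2) pr(1)] mx_pos[OF finB u' aB(1) pr(2)] by auto
    have "?P \<le> H (x + x')" by (rule low[OF u'])
    also have "\<dots> \<le> ((a \<bullet> x') * 1) * ((a' \<bullet> x) * 1)"
      unfolding H_def inner_add_right ax using le1 ge0 pr by (intro mult_mono) auto
    finally show "?P \<le> (a' \<bullet> x) * (a \<bullet> x')" by (simp add: mult.commute)
    show "(a' \<bullet> x) * (a \<bullet> x') \<le> ?P"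
    proof (rule tendsto_lowerbound[OF _ _ trivial_limit_at_right_real])
      let ?f = "\<lambda>t. (mx ?A v' p + t * mx ?A oA p) * (mx ?A' v p' + t * mx ?A' oA p')"
      have "(?f \<longlongrightarrow> (mx ?A v' p + 0 * mx ?A oA p) * (mx ?A' v p' + 0 * mx ?A' oA p')) (at_right 0)"
        by (intro tendsto_intros)
      then show "(?f \<longlongrightarrow> ?P) (at_right 0)" by simp
      show "\<forall>\<^sub>F t in at_right 0. (a' \<bullet> x) * (a \<bullet> x') \<le> ?f t"
        using eventually_at_right_less[of "0::real"]
      proof eventually_elim
        case (elim t)
        define u where "u = (v + v') + t *\<^sub>R oA"
        have u: "u \<in> opencone A" unfolding u_def
          by (intro closedcone_add_opencone closedcone_add vA opencone_scale[OF oA elim])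
        obtain u' where W: "(u, u') \<in> W" using W_left[OF u] by blast
        then have u': "u' \<in> opencone B" using W_subset by auto
        have au: "a \<bullet> u' > 0" "a' \<bullet> u' > 0" using u' aB by (auto simp: opencone_def)
        \<comment> \<open>The quotient of \<open>a'\<close> in \<open>mx B x u'\<close> and that of
          \<open>a\<close> in \<open>mx B x' u'\<close> have denominators that cancel against the
          prefactors of \<open>H\<close>.\<close>
        have "(a' \<bullet> x) * (a \<bullet> x') = ((a \<bullet> u') * (a' \<bullet> x / (a' \<bullet> u'))) * ((a' \<bullet> u') * (a \<bullet> x' / (a \<bullet> u')))"
          using au by simp
        also have "\<dots> \<le> H u'"
          unfolding H_def using au pr mx_pos[OF finB u' aB(2) pr(1)]
          by (intro mult_mono mult_left_mono mx_ge[OF finB] aB mult_nonneg_nonneg) auto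
        also have "\<dots> = \<Xi> u" using \<Xi>H[OF W] by simp
        also have "\<dots> \<le> (1 * (mx ?A v' p + t * mx ?A oA p)) * (1 * (mx ?A' v p' + t * mx ?A' oA p'))"
        proof -
          have tA: "t *\<^sub>R oA \<in> closedcone A" using oA elim opencone_subset_closedcone closedcone_scale by fastforce
          have "u - v \<in> closedcone A" "u - v' \<in> closedcone A"
            using closedcone_add[OF vA(1) tA] closedcone_add[OF vA(2) tA] by (auto simp: u_def algebra_simps)
          then have le: "mx A v u \<le> 1" "mx A v' u \<le> 1" using mx_le_1[OF finA neA' u] by auto
          have gt: "mx A v u > 0" "mx A v' u > 0"
            using mx_pos[OF finA u] pos' i j by (auto simp: active_def)
          have gt': "mx ?A u p > 0" "mx ?A' u p' > 0"
            using u opencone_active by (auto intro!: mx_pos_opencone fin_active neV p)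
          have sub: "mx (active A w) u q \<le> mx (active A w) w' q + t * mx (active A w) oA q"
            if w: "active A w \<noteq> {}" "q \<in> opencone (active A w)" and uw: "u = (w + w') + t *\<^sub>R oA" for w w' q
          proof (rule mx_le[OF fin_active w(1)])
            fix k assume k: "k \<in> active A w"
            have "k \<bullet> u / (k \<bullet> q) = k \<bullet> w' / (k \<bullet> q) + t * (k \<bullet> oA / (k \<bullet> q))"
              using k by (simp add: uw active_def inner_add_right add_divide_distrib)
            also have "\<dots> \<le> mx (active A w) w' q + t * mx (active A w) oA q"
              using elim k by (intro add_mono mult_left_mono mx_ge fin_active) auto
            finally show "k \<bullet> u / (k \<bullet> q) \<le> \<dots>" .
          qed
          have "mx ?A u p \<le> mx ?A v' p + t * mx ?A oA p"
            by (rule sub[OF neV(1) p(1)]) (simp add: u_def)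
          moreover have "mx ?A' u p' \<le> mx ?A' v p' + t * mx ?A' oA p'"
            by (rule sub[OF neV(2) p(2)]) (simp add: u_def add.commute)
          ultimately show ?thesis
            unfolding \<Xi>_def using le gt gt' by (intro mult_mono) (auto simp: less_imp_le)
        qed
        finally show ?case by simp
      qed
    qed
  qed
qed

text \<open>\<open>z\<close> is the limit of the points of the facet that correspond to \<open>r + n q\<close>, where \<open>q\<close> lies on the
  facet of \<open>i\<close>.\<close>

lemma functional_as_gauge:
  assumes va: "vertex_to_facet v a" and i: "i \<in> active A v"
  shows "\<exists>z\<in>closedcone B. a \<bullet> z = 0 \<and> (\<forall>p x. corr v a p x \<longrightarrow> i \<bullet> p = mx B z x)"
proof -
  let ?A = "active A v"
  have aB: "a \<in> B" using va by (auto simp: vertex_to_facet_def)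
  have neV: "?A \<noteq> {}" and neB': "B \<noteq> {}" using i aB by auto
  have iA: "i \<in> A" using i by (simp add: active_def)
  then obtain q where q: "i \<bullet> q = 0" "\<And>k. k \<in> A \<Longrightarrow> k \<noteq> i \<Longrightarrow> k \<bullet> q > 0"
    using irrA by (fastforce simp: irredundant_def facet_def)
  have q0: "k \<bullet> q \<ge> 0" if "k \<in> A" for k using q that by (cases "k = i") (auto simp: less_imp_le)
  obtain r where r: "r \<in> opencone A" using neA by blast
  \<comment> \<open>Along \<open>P n\<close> the functional \<open>i\<close> stays constant while
    the other active ones tend to infinity, so \<open>mx ?A p (P n)\<close> tends to
    \<open>(i \<bullet> p) / (i \<bullet> r)\<close>.\<close>
  define P where "P = (\<lambda>n::nat. r + real n *\<^sub>R q)"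
  have kP: "k \<bullet> P n = k \<bullet> r + real n * (k \<bullet> q)" for k n by (simp add: P_def inner_add_right)
  have PA: "P n \<in> opencone A" for n
    using r q0 by (auto simp: opencone_def kP intro!: add_pos_nonneg)
  then have PT: "P n \<in> opencone ?A" for n using opencone_active by blast
  then have "\<exists>x. corr v a (P n) x" for n using va by (auto simp: vertex_to_facet_def)
  then obtain x where x: "\<And>n. corr v a (P n) (x n)" by metis
  have xF: "x n \<in> facet B a" for n using x by (simp add: corr_def)
  then have xB: "x n \<in> closedcone B" for n using facet_subset_closedcone by blast
  \<comment> \<open>Gauge reversal turns the growth of \<open>P n\<close> into a decrease of
    \<open>x n\<close> in the cone order; properness then bounds the sequence and yields a
    convergent subsequence.\<close>
  have decr: "x 0 - x n \<in> closedcone B" for n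
  proof -
    have "P n - P 0 \<in> closedcone ?A"
      using q0 by (auto simp: closedcone_def active_def inner_diff_right kP)
    then have "mx ?A (P 0) (P n) \<le> 1" by (rule mx_le_1[OF fin_active neV PT])
    then have le: "mx B (x n) (x 0) \<le> 1" using corr_dual[OF va x[of n] x[of 0]] by simp
    have "b \<bullet> x n \<le> b \<bullet> x 0" if b: "b \<in> B" for b
    proof (cases "b = a")
      case True
      then show ?thesis using xF by (simp add: facet_def)
    next
      case False
      then have "b \<bullet> x 0 > 0" using xF b by (auto simp: facet_def)
      moreover have "b \<bullet> x n / (b \<bullet> x 0) \<le> 1" using mx_ge[OF finB b, of "x n" "x 0"] le by linarith
      ultimately show ?thesis by simp
    qed
    then show ?thesis by (simp add: closedcone_def inner_diff_right)
  qed
  have "norm (x n) \<le> \<kappa> * (e \<bullet> x 0)" for n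
    using proper[OF xB[of n]] proper[OF decr[of n]] norm_ge_zero[of "x 0 - x n"]
    unfolding inner_diff_right right_diff_distrib by linarith
  then have "bounded (range x)" by (auto simp: bounded_iff)
  then obtain l \<rho> where \<rho>: "strict_mono \<rho>" and l: "(x \<circ> \<rho>) \<longlonglongrightarrow> l"
    using bounded_imp_convergent_subsequence by blast
  have lB: "l \<in> closedcone B"
    using xB by (intro closed_sequentially[OF closed_closedcone _ l]) simp
  have "(\<lambda>n. a \<bullet> (x \<circ> \<rho>) n) \<longlonglongrightarrow> a \<bullet> l" by (intro tendsto_intros l)
  then have al: "a \<bullet> l = 0"
    using xF by (simp add: facet_def LIMSEQ_const_iff)
  have ir: "i \<bullet> r > 0" using r iA by (auto simp: opencone_def)
  have lim: "mx B l y = i \<bullet> p / (i \<bullet> r)" if c: "corr v a p y" for p y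
  proof -
    have p: "p \<in> opencone ?A" using c by (simp add: corr_def)
    have "(\<lambda>n. mx B ((x \<circ> \<rho>) n) y) \<longlonglongrightarrow> mx B l y"
      unfolding mx_def divide_inverse by (intro tendsto_Max finB neB' tendsto_intros l)
    moreover have "mx B ((x \<circ> \<rho>) n) y = mx ?A p (P (\<rho> n))" for n
      using corr_dual[OF va x c] by simp
    moreover have "(\<lambda>n. mx ?A p (P (\<rho> n))) \<longlonglongrightarrow> Max ((\<lambda>k. if k = i then i \<bullet> p / (i \<bullet> r) else 0) ` ?A)"
      unfolding mx_def
    proof (intro tendsto_Max fin_active neV)
      fix k assume k: "k \<in> ?A"
      show "(\<lambda>n. k \<bullet> p / (k \<bullet> P (\<rho> n))) \<longlonglongrightarrow> (if k = i then i \<bullet> p / (i \<bullet> r) else 0)"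
      proof (cases "k = i")
        case True
        then show ?thesis using q by (simp add: kP)
      next
        case False
        then have "k \<bullet> q > 0" using q k by (auto simp: active_def)
        then have "filterlim (\<lambda>n. real n * (k \<bullet> q)) at_top sequentially"
          by (intro filterlim_at_top_mult_tendsto_pos[OF tendsto_const _ filterlim_real_sequentially])
        then have "filterlim (\<lambda>n. k \<bullet> P n) at_infinity sequentially"
          unfolding kP
          by (intro filterlim_at_top_imp_at_infinity filterlim_tendsto_add_at_top[OF tendsto_const])
        then have "(\<lambda>n. k \<bullet> p / (k \<bullet> P n)) \<longlonglongrightarrow> 0"
          by (rule tendsto_divide_0[OF tendsto_const])
        then have "(\<lambda>n. k \<bullet> p / (k \<bullet> P (\<rho> n))) \<longlonglongrightarrow> 0"
          using LIMSEQ_subseq_LIMSEQ[OF _ \<rho>] by (fastforce simp: o_def)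
        then show ?thesis using False by simp
      qed
    qed
    moreover have "Max ((\<lambda>k. if k = i then i \<bullet> p / (i \<bullet> r) else 0) ` ?A) = i \<bullet> p / (i \<bullet> r)"
      using i p ir fin_active by (intro Max_eqI) (auto simp: opencone_def less_imp_le)
    ultimately show ?thesis using LIMSEQ_unique by auto
  qed
  show ?thesis
  proof (intro bexI[of _ "(i \<bullet> r) *\<^sub>R l"] conjI allI impI)
    show "i \<bullet> p = mx B ((i \<bullet> r) *\<^sub>R l) y" if "corr v a p y" for p y
      using lim[OF that] ir by (simp add: mx_scale_left finB neB')
  qed (use al lB ir in \<open>auto intro: closedcone_scale[OF _ less_imp_le]\<close>)
qed

text \<open>On the facet of \<open>a\<close>, the functional \<open>a'\<close> is a maximum of the concave functions
  \<open>x \<mapsto> sup {t. x - t w \<in> closedcone B}\<close> with \<open>w\<close> in the finite set \<open>V\<close>.\<close>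

lemma facet_apex:
  assumes va: "vertex_to_facet v a" and va': "vertex_to_facet v' a'"
    and sep: "separated v v'" "separated v' v"
  shows "\<exists>w. apex a a' w"
proof -
  let ?A = "active A v"
  have aB: "a \<in> B" "a' \<in> B" and neV: "?A \<noteq> {}" and v'A: "v' \<in> closedcone A"
    using va va' by (auto simp: vertex_to_facet_def)
  have neB': "B \<noteq> {}" using aB by auto
  obtain oA where "oA \<in> opencone A" using neA by blast
  then obtain p0 x0 where c0: "corr v' a' p0 x0"
    using va' opencone_active[of A v'] by (fastforce simp: vertex_to_facet_def)
  obtain x1 p1 where c1: "corr v a p1 x1"
    using va \<open>oA \<in> opencone A\<close> opencone_active[of A v] by (fastforce simp: vertex_to_facet_def)
  then have x1: "x1 \<in> facet B a" by (simp add: corr_def)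
  have aa': "a \<noteq> a'" using gromov_product(1)[OF va va' sep c1 c0] .
  obtain j where "j \<in> active A v'" "j \<bullet> v > 0" using sep by (auto simp: separated_def)
  then have m: "mx (active A v') v p0 > 0"
    using c0 by (intro mx_pos[OF fin_active]) (auto simp: corr_def)
  have ax0: "a \<bullet> x0 > 0" using c0 aB aa' by (auto simp: corr_def facet_def)
  \<comment> \<open>With the pair \<open>(p0, x0)\<close> at \<open>v'\<close> fixed, the product
    identity makes \<open>a' \<bullet> x\<close> a constant multiple of
    \<open>mx ?A v' p\<close>.\<close>
  define K where "K = mx (active A v') v p0 / (a \<bullet> x0)"
  have K: "K > 0" using m ax0 by (simp add: K_def)
  have a'x: "a' \<bullet> x = K * mx ?A v' p" if "corr v a p x" for p x
    using gromov_product(2)[OF va va' sep that c0] ax0 by (simp add: K_def field_simps)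
  obtain z where z: "\<And>i. i \<in> ?A \<Longrightarrow> z i \<in> closedcone B \<and> a \<bullet> z i = 0 \<and>
      (\<forall>p x. corr v a p x \<longrightarrow> i \<bullet> p = mx B (z i) x)"
    using functional_as_gauge[OF va] by metis
  define I where "I = {i \<in> ?A. i \<bullet> v' > 0}"
  \<comment> \<open>As \<open>i \<bullet> p = mx B (z i) x\<close>, this scaling makes the term of
    \<open>i\<close> in \<open>K * mx ?A v' p\<close> the largest \<open>t\<close> with
    \<open>x - t (w i)\<close> in the closed cone. Terms with \<open>i \<bullet> v' = 0\<close>
    never attain the positive maximum.\<close>
  define w where "w = (\<lambda>i. (1 / (K * (i \<bullet> v'))) *\<^sub>R z i)"
  define V where "V = w ` I"
  define B' where "B' = insert (- a) B"
  have B': "x \<in> closedcone B' \<longleftrightarrow> x \<in> closedcone B \<and> a \<bullet> x = 0" for x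
    using closedcone_insert_uminus[OF aB(1)] by (simp add: B'_def)
  have VB': "V \<subseteq> closedcone B'"
    using z K by (auto simp: V_def B' I_def w_def intro!: closedcone_scale)
  have ex: "\<exists>p. corr v a p x" if "x \<in> facet B a" for x using va that by (auto simp: vertex_to_facet_def)
  have V1: "1 \<le> a' \<bullet> y" if "y \<in> V" for y
  proof -
    obtain i where i: "i \<in> I" "y = w i" using \<open>y \<in> V\<close> by (auto simp: V_def)
    then have iA: "i \<in> ?A" "i \<bullet> v' > 0" by (auto simp: I_def)
    have yB: "y \<in> closedcone B" "a \<bullet> y = 0" using VB' that B' by auto
    have "y \<in> {y. 1 \<le> a' \<bullet> y}"
    proof (rule closed_line_limit)
      show "closed {y. 1 \<le> a' \<bullet> y}" by (rule closed_halfspace_ge)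
      fix t :: real assume t: "t > 0"
      have xF: "y + t *\<^sub>R x1 \<in> facet B a"
        using yB x1 t by (auto simp: facet_def closedcone_def inner_add_right intro!: add_nonneg_pos)
      then obtain p where c: "corr v a p (y + t *\<^sub>R x1)" using ex by blast
      then have ip: "i \<bullet> p > 0" using iA by (auto simp: corr_def opencone_def)
      have "mx B (z i) (y + t *\<^sub>R x1) \<le> K * (i \<bullet> v')"
      proof (rule mx_le[OF finB neB'])
        fix b assume b: "b \<in> B"
        show "b \<bullet> z i / (b \<bullet> (y + t *\<^sub>R x1)) \<le> K * (i \<bullet> v')"
        proof (cases "b = a")
          case True
          then show ?thesis using z[OF iA(1)] K iA by simp
        next
          case False
          have "b \<bullet> z i = K * (i \<bullet> v') * (b \<bullet> y)" using i(2) K iA by (simp add: w_def)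
          also have "\<dots> \<le> K * (i \<bullet> v') * (b \<bullet> (y + t *\<^sub>R x1))"
            using K iA x1 b False t
            by (intro mult_left_mono) (auto simp: inner_add_right facet_def less_imp_le)
          finally show ?thesis using xF b False by (simp add: facet_def pos_divide_le_eq)
        qed
      qed
      then have "i \<bullet> p \<le> K * (i \<bullet> v')" using z[OF iA(1)] c by simp
      then have "1 \<le> K * (i \<bullet> v' / (i \<bullet> p))" using ip by simp
      also have "\<dots> \<le> a' \<bullet> (y + t *\<^sub>R x1)"
        unfolding a'x[OF c] using K by (intro mult_left_mono mx_ge fin_active iA) auto
      finally show "y + t *\<^sub>R x1 \<in> {y. 1 \<le> a' \<bullet> y}" by simp
    qed
    then show ?thesis by simp
  qed
  \<comment> \<open>At a point of the open facet, the \<open>i\<close> attaining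
    \<open>mx ?A v' p\<close> serves; the set of points served is closed because \<open>V\<close> is
    finite.\<close>
  have cover: "\<exists>y\<in>V. x - (a' \<bullet> x) *\<^sub>R y \<in> closedcone B'" if x: "x \<in> closedcone B'" for x
  proof -
    define S where "S = (\<Union>y\<in>V. {x. x - (a' \<bullet> x) *\<^sub>R y \<in> closedcone B'})"
    have "closed {x. x - (a' \<bullet> x) *\<^sub>R y \<in> closedcone B'}" for y
      using closed_vimage[OF closed_closedcone[of B'], of "\<lambda>x. x - (a' \<bullet> x) *\<^sub>R y"]
      by (simp add: vimage_def continuous_intros)
    moreover have "finite V" using fin_active by (simp add: V_def I_def)
    ultimately have "closed S" by (auto simp: S_def)
    then have "x \<in> S"
    proof (rule closed_line_limit)
      fix t :: real assume t: "t > 0"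
      define y where "y = x + t *\<^sub>R x1"
      have yF: "y \<in> facet B a"
        using x[unfolded B'] x1 t by (auto simp: y_def facet_def closedcone_def inner_add_right intro!: add_nonneg_pos)
      then obtain p where c: "corr v a p y" using ex by blast
      then have p: "p \<in> opencone ?A" by (simp add: corr_def)
      obtain i where i: "i \<in> ?A" "mx ?A v' p = i \<bullet> v' / (i \<bullet> p)"
        using mx_attained[OF fin_active neV] by blast
      have ip: "i \<bullet> p > 0" using i p by (auto simp: opencone_def)
      have "a' \<bullet> y > 0" using yF aB aa' by (auto simp: facet_def)
      then have iv: "i \<bullet> v' > 0" using a'x[OF c] i K ip by (simp add: zero_less_mult_iff zero_less_divide_iff)
      have "0 \<le> b \<bullet> (y - (a' \<bullet> y) *\<^sub>R w i)" if b: "b \<in> B" for b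
      proof (cases "b = a")
        case True
        then show ?thesis using yF z[OF i(1)] by (simp add: facet_def inner_diff_right w_def)
      next
        case False
        then have by0: "b \<bullet> y > 0" using yF b by (auto simp: facet_def)
        have "b \<bullet> z i / (b \<bullet> y) \<le> i \<bullet> p" using mx_ge[OF finB b, of "z i" y] z[OF i(1)] c by simp
        then have "b \<bullet> z i \<le> (i \<bullet> p) * (b \<bullet> y)" using by0 by (simp add: pos_divide_le_eq)
        then have "(b \<bullet> z i) / (i \<bullet> p) \<le> b \<bullet> y" using ip by (simp add: pos_divide_le_eq mult.commute)
        moreover have "(a' \<bullet> y) * (b \<bullet> w i) = (b \<bullet> z i) / (i \<bullet> p)"
          using a'x[OF c] i(2) K iv by (simp add: w_def)
        ultimately show ?thesis by (simp add: inner_diff_right)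
      qed
      moreover have "a \<bullet> (y - (a' \<bullet> y) *\<^sub>R w i) = 0"
        using yF z[OF i(1)] by (simp add: facet_def inner_diff_right w_def)
      ultimately have "y - (a' \<bullet> y) *\<^sub>R w i \<in> closedcone B'"
        unfolding B' by (simp add: closedcone_def)
      moreover have "w i \<in> V" using i(1) iv by (simp add: V_def I_def)
      ultimately show "x + t *\<^sub>R x1 \<in> S" unfolding S_def y_def by blast
    qed
    then show ?thesis by (auto simp: S_def)
  qed
  obtain y where "y \<in> closedcone B'" "a' \<bullet> y = 1"
    "\<And>x. x \<in> closedcone B' \<Longrightarrow> x - (a' \<bullet> x) *\<^sub>R y \<in> closedcone B'"
  proof (rule cone_apex[of B' \<kappa> e V a'])
    show "norm u \<le> \<kappa> * (e \<bullet> u)" if "u \<in> closedcone B'" for u using that proper B' by blast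
    show "finite V" using fin_active by (simp add: V_def I_def)
    show "0 \<le> a' \<bullet> u" if "u \<in> closedcone B'" for u using that aB B' by (auto simp: closedcone_def)
  qed (use VB' V1 cover in auto)
  then have "apex a a' y" by (auto simp: apex_def B')
  then show ?thesis by blast
qed

text \<open>The apexes of the pyramids over one facet, together with one apex from another facet, form a
  basis dual to the functionals \<open>k v\<close>.\<close>

lemma dual_system:
  assumes V: "v0 \<in> V" "v1 \<in> V" "v0 \<noteq> v1"
    and vf: "\<And>v. v \<in> V \<Longrightarrow> vertex_to_facet v (k v)"
    and sep: "\<And>v v'. v \<in> V \<Longrightarrow> v' \<in> V \<Longrightarrow> v \<noteq> v' \<Longrightarrow> separated v v'"
  shows "\<exists>d. (\<forall>v\<in>V. d v \<in> closedcone B \<and> k v \<in> B) \<and>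
    (\<forall>v\<in>V. \<forall>v'\<in>V. k v \<bullet> d v' = (if v = v' then 1 else 0))"
proof -
  have kB: "k v \<in> B" if "v \<in> V" for v using vf[OF that] by (simp add: vertex_to_facet_def)
  obtain oA where "oA \<in> opencone A" using neA by blast
  then have "\<exists>p x. corr v (k v) p x" if "v \<in> V" for v
    using vf[OF that] opencone_active[of A v] by (fastforce simp: vertex_to_facet_def)
  then have kne: "k v \<noteq> k v'" if "v \<in> V" "v' \<in> V" "v \<noteq> v'" for v v'
    using gromov_product(1)[OF vf vf sep sep] that by metis
  have "\<exists>w. apex (k v) (k v') w" if "v \<in> V" "v' \<in> V" "v \<noteq> v'" for v v'
    using facet_apex[OF vf vf sep sep] that by metis
  then obtain w where w: "\<And>v v'. v \<in> V \<Longrightarrow> v' \<in> V \<Longrightarrow> v \<noteq> v' \<Longrightarrow> apex (k v) (k v') (w v v')"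
    by metis
  \<comment> \<open>All vectors are apexes in the facet of \<open>k v0\<close>, except the one dual
    to \<open>k v0\<close> itself, which has to come from another facet.\<close>
  define d where "d = (\<lambda>v. if v = v0 then w v1 v0 else w v0 v)"
  have wk: "k v'' \<bullet> w v v' = (if v'' = v' then 1 else 0)"
    if "v \<in> V" "v' \<in> V" "v'' \<in> V" "v \<noteq> v'" for v v' v''
  proof (cases "v'' = v \<or> v'' = v'")
    case True
    then show ?thesis using w[OF that(1,2,4)] that by (auto simp: apex_def)
  next
    case False
    then show ?thesis
      using apex_orthogonal[of "k v" "k v''" "k v'" "w v v''" "w v v'"] that w kB kne by auto
  qed
  show ?thesis
  proof (intro exI[of _ d] conjI ballI)
    show "d v \<in> closedcone B" if "v \<in> V" for v
      using w[of v1 v0] w[of v0 v] V that by (auto simp: d_def apex_def)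
    show "k v \<bullet> d v' = (if v = v' then 1 else 0)" if "v \<in> V" "v' \<in> V" for v v'
      using V that by (auto simp: d_def wk)
  qed (rule kB)
qed

end

section \<open>Hilbert metric, faces of cones and simplices\<close>

lemma open_segment_extension:
  fixes u z :: "'b::real_vector"
  assumes "0 < \<epsilon>" "u \<noteq> z"
  shows "z \<in> open_segment u (z + \<epsilon> *\<^sub>R (z - u))"
  unfolding in_segment
proof (intro conjI exI[of _ "1 / (1 + \<epsilon>)"])
  define c where "c = 1 / (1 + \<epsilon>)"
  have c: "c * \<epsilon> = 1 - c" using assms(1) by (simp add: c_def field_simps)
  have "c *\<^sub>R (z + \<epsilon> *\<^sub>R (z - u)) = c *\<^sub>R z + (1 - c) *\<^sub>R (z - u)"
    by (simp only: scaleR_right_distrib scaleR_scaleR c)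
  then show "z = (1 - 1 / (1 + \<epsilon>)) *\<^sub>R u + (1 / (1 + \<epsilon>)) *\<^sub>R (z + \<epsilon> *\<^sub>R (z - u))"
    unfolding c_def[symmetric] by (simp add: algebra_simps)
  show "u \<noteq> z + \<epsilon> *\<^sub>R (z - u)"
  proof
    assume "u = z + \<epsilon> *\<^sub>R (z - u)"
    then have "(1 + \<epsilon>) *\<^sub>R (z - u) = 0" by (simp add: algebra_simps)
    then show False using assms by simp
  qed
qed (use assms in auto)

text \<open>A ray from an interior point of a bounded convex set meets the frontier exactly once, so
  the definite description in \<open>chord_end\<close> denotes that point.\<close>

lemma chord_end_ray:
  assumes X: "open X" "convex X" "bounded X" and x: "x \<in> X" and xy: "x \<noteq> y"
  obtains t where "t > 0" "chord_end X x y = x + t *\<^sub>R (x - y)"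
proof -
  have xi: "x \<in> interior X" using X x by (simp add: interior_open)
  obtain d where d: "0 < d" "x + d *\<^sub>R (x - y) \<in> frontier X"
    and in_X: "\<And>s. 0 \<le> s \<Longrightarrow> s < d \<Longrightarrow> x + s *\<^sub>R (x - y) \<in> interior X"
    using ray_to_frontier[OF X(3) xi, of "x - y"] xy by auto
  have unique: "p = x + d *\<^sub>R (x - y)" if p: "p \<in> frontier X" "t > 0" "p = x + t *\<^sub>R (x - y)" for p t
  proof (cases t d rule: linorder_cases)
    case less
    then show ?thesis using in_X[of t] p by (auto simp: frontier_def)
  next
    case greater
    have "x + d *\<^sub>R (x - y) \<in> open_segment x p"
      unfolding in_segment
    proof (intro conjI exI[of _ "d / t"])
      show "x \<noteq> p" using p xy by auto
      show "x + d *\<^sub>R (x - y) = (1 - d / t) *\<^sub>R x + (d / t) *\<^sub>R p"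
        using p(2) unfolding p(3) by (simp add: scaleR_right_distrib scaleR_left_diff_distrib)
    qed (use d greater in auto)
    then have "x + d *\<^sub>R (x - y) \<in> interior X"
      using in_interior_closure_convex_segment[OF X(2) xi, of p] p(1) by (auto simp: frontier_def)
    then show ?thesis using d by (simp add: frontier_def)
  qed (use p in simp)
  have "chord_end X x y = x + d *\<^sub>R (x - y)"
    unfolding chord_end_def using d unique by (intro the_equality) blast+
  with d(1) show thesis by (rule that)
qed

text \<open>With chord parameters \<open>s\<close> and \<open>t\<close> the argument of
  \<open>ln\<close> is \<open>(1 + s) (1 + t) / (s t)\<close>, which exceeds \<open>1\<close>. This
  makes isometries injective.\<close>

lemma hilbert_dist_pos:
  assumes X: "open X" "convex X" "bounded X" and xy: "x \<in> X" "y \<in> X" "x \<noteq> y"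
  shows "hilbert_dist X x y > 0"
proof -
  obtain s where s: "s > 0" "chord_end X x y = x + s *\<^sub>R (x - y)"
    using chord_end_ray[OF X xy(1,3)] by blast
  obtain t where t: "t > 0" "chord_end X y x = y + t *\<^sub>R (y - x)"
    using chord_end_ray[OF X xy(2) xy(3)[symmetric]] by blast
  have n: "norm (x - y) > 0" "norm (y - x) = norm (x - y)" using xy by (auto simp: norm_minus_commute)
  have 1: "dist (x + s *\<^sub>R (x - y)) y = (1 + s) * norm (x - y)" "dist (y + t *\<^sub>R (y - x)) x = (1 + t) * norm (x - y)"
  proof -
    have "x + s *\<^sub>R (x - y) - y = (1 + s) *\<^sub>R (x - y)" "y + t *\<^sub>R (y - x) - x = (1 + t) *\<^sub>R (y - x)"
      by (simp_all add: algebra_simps)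
    then show "dist (x + s *\<^sub>R (x - y)) y = (1 + s) * norm (x - y)"
      "dist (y + t *\<^sub>R (y - x)) x = (1 + t) * norm (x - y)"
      using abs_of_pos[of "1 + s"] abs_of_pos[of "1 + t"] s(1) t(1) n(2)
      by (simp_all only: dist_norm norm_scaleR add_pos_pos zero_less_one)
  qed
  have 2: "dist (x + s *\<^sub>R (x - y)) x = s * norm (x - y)" "dist (y + t *\<^sub>R (y - x)) y = t * norm (x - y)"
    using abs_of_pos[OF s(1)] abs_of_pos[OF t(1)] n(2)
    by (simp_all only: dist_norm norm_scaleR add_diff_cancel_left')
  have "s * N * (t * N) < (1 + s) * N * ((1 + t) * N)" if "N > 0" for N :: real
    using s(1) t(1) that by (intro mult_strict_mono mult_strict_right_mono mult_pos_pos mult_nonneg_nonneg) auto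
  from this[OF n(1)] have "s * norm (x - y) * (t * norm (x - y)) < (1 + s) * norm (x - y) * ((1 + t) * norm (x - y))" .
  then show ?thesis
    using xy s t n by (simp add: hilbert_dist_def Let_def 1 2)
qed

text \<open>A proper face avoids the interior, so some functional vanishes at a relative interior
  point of \<open>G\<close> and hence on all of \<open>G\<close>; two of them would force
  codimension two.\<close>

lemma face_is_facet:
  fixes B :: "'b::euclidean_space set"
  assumes finB: "finite B" and neB: "opencone B \<noteq> {}" and irr: "irredundant B"
    and G: "G face_of closedcone B" and dim: "aff_dim G = int DIM('b) - 1"
  shows "\<exists>a\<in>B. rel_interior G = facet B a"
proof -
  have GB: "G \<subseteq> closedcone B" and convG: "convex G"
    using G face_of_imp_subset face_of_imp_convex by auto
  have neG: "G \<noteq> {}"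
  proof -
    have "aff_dim G \<ge> 0" using dim DIM_positive[where 'a='b] by linarith
    then show ?thesis by auto
  qed
  obtain oB where oB: "oB \<in> opencone B" using neB by blast
  have ex_active: "\<exists>a\<in>B. a \<bullet> z = 0" if z: "z \<in> G" for z
  proof (rule ccontr)
    assume "\<not> ?thesis"
    then have "z \<in> opencone B" using z GB by (force simp: opencone_def closedcone_def)
    then have "z \<in> interior (closedcone B)"
      using interior_maximal[OF opencone_subset_closedcone open_opencone[OF finB]] by blast
    then have "G = closedcone B" using face_of_disjoint_interior[OF G] z by blast
    then have "aff_dim G = int DIM('b)"
      using aff_dim_nonempty_interior[of "closedcone B"] \<open>z \<in> interior (closedcone B)\<close> by blast
    then show False using dim by simp
  qed
  \<comment> \<open>The segment from \<open>y\<close> through \<open>z\<close> continues within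
    \<open>G\<close>; a functional nonnegative at both ends and zero at \<open>z\<close> vanishes at
    \<open>y\<close>.\<close>
  have vanish: "a \<bullet> y = 0" if z: "z \<in> rel_interior G" and a: "a \<in> B" "a \<bullet> z = 0" and y: "y \<in> G" for z a y
  proof -
    obtain m where m: "m > 1" "(1 - m) *\<^sub>R y + m *\<^sub>R z \<in> G"
      using convex_rel_interior_iff[OF convG neG] z y by blast
    then have "0 \<le> a \<bullet> ((1 - m) *\<^sub>R y + m *\<^sub>R z)" using GB a by (auto simp: closedcone_def)
    then have "a \<bullet> y \<le> 0" using a m(1) by (simp add: inner_add_right zero_le_mult_iff)
    moreover have "a \<bullet> y \<ge> 0" using GB y a by (auto simp: closedcone_def)
    ultimately show ?thesis by simp
  qed
  have unique: "a = b" if z: "z \<in> rel_interior G" and a: "a \<in> B" "a \<bullet> z = 0" and b: "b \<in> B" "b \<bullet> z = 0" for z a b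
  proof (rule ccontr)
    assume ab: "a \<noteq> b"
    let ?S = "{u. a \<bullet> u = 0}" and ?S' = "{u. a \<bullet> u = 0} \<inter> {u. b \<bullet> u = 0}"
    have sub: "subspace ?S" "subspace ?S'" by (auto intro!: subspace_inter subspace_hyperplane)
    obtain q where "q \<in> facet B a" using irr a by (auto simp: irredundant_def)
    then have "q \<in> ?S" "q \<notin> ?S'" using b(1) ab unfolding facet_def by force+
    then have "?S' \<subset> ?S" by blast
    then have "dim ?S' < dim ?S"
      using dim_psubset[of ?S' ?S] by (simp only: span_eq_iff[THEN iffD2, OF sub(1)] span_eq_iff[THEN iffD2, OF sub(2)])
    moreover have "a \<noteq> 0" using oB a by (auto simp: opencone_def)
    then have "dim ?S = DIM('b) - 1" using dim_hyperplane by blast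
    moreover have "G \<subseteq> ?S'" using vanish[OF z] a b by blast
    then have "aff_dim G \<le> int (dim ?S')" using aff_dim_subset aff_dim_subspace[OF sub(2)] by metis
    ultimately show False using dim by linarith
  qed
  obtain z where z: "z \<in> rel_interior G" using rel_interior_eq_empty[OF convG] neG by blast
  have zG: "z \<in> G" using z rel_interior_subset by blast
  obtain a where a: "a \<in> B" "a \<bullet> z = 0" using ex_active[OF zG] by blast
  have zF: "z \<in> facet B a"
    using a unique[OF z] zG GB by (force simp: facet_def closedcone_def)
  \<comment> \<open>A point \<open>u\<close> of the closed facet lies in \<open>G\<close> because
    the segment from \<open>u\<close> through \<open>z\<close> continues past \<open>z\<close> in
    the cone, and \<open>G\<close> is a face containing \<open>z\<close>.\<close>
  have G_eq: "G = {u \<in> closedcone B. a \<bullet> u = 0}"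
  proof
    show "G \<subseteq> {u \<in> closedcone B. a \<bullet> u = 0}" using vanish[OF z a] GB by blast
    show "{u \<in> closedcone B. a \<bullet> u = 0} \<subseteq> G"
    proof
      fix u assume u: "u \<in> {u \<in> closedcone B. a \<bullet> u = 0}"
      show "u \<in> G"
      proof (cases "u = z")
        case False
        obtain \<epsilon> where \<epsilon>: "\<epsilon> > 0" "z + \<epsilon> *\<^sub>R (z - u) \<in> facet B a"
          using facet_step[OF finB zF, of "z - u"] u a by (auto simp: inner_diff_right)
        have "z \<in> open_segment u (z + \<epsilon> *\<^sub>R (z - u))"
          using \<epsilon>(1) False by (intro open_segment_extension) auto
        then show ?thesis
          using G zG u \<epsilon>(2) facet_subset_closedcone unfolding face_of_def by blast
      qed (use zG in simp)
    qed
  qed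
  have "rel_interior G = facet B a"
  proof
    show "rel_interior G \<subseteq> facet B a"
    proof
      fix u assume u: "u \<in> rel_interior G"
      then have uG: "u \<in> G" using rel_interior_subset by blast
      then have "a \<bullet> u = 0" using vanish[OF z a] by blast
      then show "u \<in> facet B a" using unique[OF u _ _ a(1)] uG GB by (force simp: facet_def closedcone_def)
    qed
    show "facet B a \<subseteq> rel_interior G"
    proof
      fix u assume u: "u \<in> facet B a"
      have "\<exists>m>1. (1 - m) *\<^sub>R y + m *\<^sub>R u \<in> G" if y: "y \<in> G" for y
      proof -
        have "a \<bullet> (u - y) = 0" using y u by (simp add: G_eq facet_def inner_diff_right)
        then obtain \<epsilon> where \<epsilon>: "\<epsilon> > 0" "u + \<epsilon> *\<^sub>R (u - y) \<in> facet B a"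
          using facet_step[OF finB u] by blast
        have "u + \<epsilon> *\<^sub>R (u - y) \<in> G"
          using \<epsilon>(2) facet_subset_closedcone unfolding G_eq by (auto simp: facet_def)
        moreover have "(1 - (1 + \<epsilon>)) *\<^sub>R y + (1 + \<epsilon>) *\<^sub>R u = u + \<epsilon> *\<^sub>R (u - y)"
          by (simp add: algebra_simps)
        ultimately show ?thesis using \<epsilon>(1) by (intro exI[of _ "1 + \<epsilon>"]) simp
      qed
      then show "u \<in> rel_interior G" using convex_rel_interior_iff[OF convG neG] by blast
    qed
  qed
  with a(1) show ?thesis by blast
qed

text \<open>As \<open>X\<close> is open, \<open>S\<close> spans full dimension and needs at least
  \<open>DIM('a) + 1\<close> points; equality makes them affinely independent.\<close>

lemma open_simplexI:
  fixes X :: "'a::euclidean_space set"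
  assumes X: "open X" "convex X" "X \<noteq> {}" and S: "closure X = convex hull S" "finite S" "card S \<le> DIM('a) + 1"
  shows "open_simplex X" "card S = DIM('a) + 1"
proof -
  have dim: "aff_dim S = int DIM('a)"
    using aff_dim_open[OF X(1,3)] S(1) by (metis closure_aff_dim aff_dim_convex_hull)
  then have "int DIM('a) \<le> int (card S) - 1" using aff_dim_le_card[OF S(2)] by simp
  then show card: "card S = DIM('a) + 1" using S(3) by linarith
  then have "\<not> affine_dependent S"
    using dim S(2) by (simp add: affine_independent_iff_card)
  moreover have "X = interior (convex hull S)"
    using convex_interior_closure[OF X(2)] X(1) S(1) by (simp add: interior_open)
  ultimately show "open_simplex X" unfolding open_simplex_def using card S(2) by blast
qed

text \<open>Pairing a linear combination of the vectors \<open>d v\<close> with \<open>k v\<close>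
  reads off the coefficient at \<open>d v\<close>.\<close>

lemma dual_independent:
  fixes d k :: "'i \<Rightarrow> 'b::euclidean_space"
  assumes fin: "finite V" and dual: "\<And>v v'. v \<in> V \<Longrightarrow> v' \<in> V \<Longrightarrow> k v \<bullet> d v' = (if v = v' then 1 else 0)"
  shows "card V \<le> DIM('b)"
    and "card V = DIM('b) \<Longrightarrow> x = (\<Sum>v\<in>V. (k v \<bullet> x) *\<^sub>R d v)"
proof -
  have inj: "inj_on d V"
  proof (rule inj_onI, rule ccontr)
    fix v v' assume "v \<in> V" "v' \<in> V" "d v = d v'" "v \<noteq> v'"
    then show False using dual[of v v'] dual[of v v] by simp
  qed
  have coef: "k v \<bullet> (\<Sum>w\<in>d ` V. u w *\<^sub>R w) = u (d v)" if "v \<in> V" for u v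
  proof -
    have "k v \<bullet> (\<Sum>w\<in>d ` V. u w *\<^sub>R w) = (\<Sum>w\<in>V. if w = v then u (d w) else 0)"
      using that by (auto simp: sum.reindex[OF inj] inner_sum_right dual intro!: sum.cong)
    then show ?thesis using fin that by simp
  qed
  have ind: "independent (d ` V)"
  proof
    assume "dependent (d ` V)"
    then obtain u v where v: "v \<in> V" "u (d v) \<noteq> 0" and "(\<Sum>w\<in>d ` V. u w *\<^sub>R w) = 0"
      using dependent_finite[of "d ` V"] fin by auto
    then show False using coef[of v u] by simp
  qed
  show "card V \<le> DIM('b)" using independent_bound[OF ind] card_image[OF inj] by simp
  assume "card V = DIM('b)"
  then have "UNIV \<subseteq> span (d ` V)"
    by (intro card_ge_dim_independent ind) (auto simp: card_image[OF inj])
  then obtain u where u: "x = (\<Sum>w\<in>d ` V. u w *\<^sub>R w)"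
    using span_finite[of "d ` V"] fin by auto
  then have "x = (\<Sum>v\<in>V. u (d v) *\<^sub>R d v)" by (simp add: sum.reindex[OF inj])
  also have "\<dots> = (\<Sum>v\<in>V. (k v \<bullet> x) *\<^sub>R d v)"
    using coef[of _ u] u by (intro sum.cong) auto
  finally show "x = (\<Sum>v\<in>V. (k v \<bullet> x) *\<^sub>R d v)" .
qed

section \<open>From polyhedral sets to cones\<close>

lemma inner_pair_unit: "(0, 1) \<bullet> u = snd (u :: 'a::real_inner \<times> real)"
  by (cases u) (simp add: inner_Pair)

lemma cone_over_iff: "u \<in> cone_over X \<longleftrightarrow> snd u > 0 \<and> (1 / snd u) *\<^sub>R fst u \<in> X"
proof
  assume "u \<in> cone_over X"
  then show "snd u > 0 \<and> (1 / snd u) *\<^sub>R fst u \<in> X" by (auto simp: cone_over_def lift_def)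
next
  assume "snd u > 0 \<and> (1 / snd u) *\<^sub>R fst u \<in> X"
  moreover from this have "u = snd u *\<^sub>R lift ((1 / snd u) *\<^sub>R fst u)"
    by (simp add: lift_def prod_eq_iff)
  ultimately show "u \<in> cone_over X" unfolding cone_over_def by blast
qed

lemma polyhedral_open_convex:
  assumes "polyhedral_hilbert X"
  shows "open X" "convex X" "bounded X" "X \<noteq> {}"
proof -
  obtain H where "finite H" and X: "X = (\<Inter>(a,c)\<in>H. {x. a \<bullet> x < c})"
    using assms by (auto simp: polyhedral_hilbert_def)
  then show "open X" by (auto intro!: open_INT open_halfspace_lt)
  show "convex X" unfolding X by (auto intro!: convex_INT convex_halfspace_lt)
qed (use assms in \<open>auto simp: polyhedral_hilbert_def\<close>)

lemma polyhedral_cone: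
  fixes X :: "'a::euclidean_space set"
  assumes "polyhedral_hilbert X"
  obtains A \<kappa> where "finite A" "irredundant A" "opencone A = cone_over X" "\<kappa> > 0"
    "\<And>u. u \<in> closedcone A \<Longrightarrow> norm u \<le> \<kappa> * ((0, 1) \<bullet> u)"
proof -
  obtain H where fin: "finite H" and X: "X = (\<Inter>(a,c)\<in>H. {x. a \<bullet> x < c})"
    using assms by (auto simp: polyhedral_hilbert_def)
  \<comment> \<open>A half-space \<open>a \<bullet> x < c\<close> homogenises to the functional
    \<open>(- a, c)\<close>; \<open>(0, 1)\<close> forces positive height.\<close>
  define A0 where "A0 = insert (0, 1) ((\<lambda>(a,c). (- a, c)) ` H)"
  have "u \<in> opencone A0 \<longleftrightarrow> u \<in> cone_over X" for u :: "'a \<times> real"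
  proof (cases u)
    case (Pair y s)
    have "u \<in> opencone A0 \<longleftrightarrow> s > 0 \<and> (\<forall>(a,c)\<in>H. a \<bullet> y < c * s)"
      unfolding Pair by (auto simp: opencone_def A0_def inner_Pair split_beta)
    also have "\<dots> \<longleftrightarrow> u \<in> cone_over X"
      unfolding cone_over_iff Pair X by (auto simp: pos_divide_less_eq)
    finally show ?thesis .
  qed
  then have A0: "opencone A0 = cone_over X" by blast
  have ne: "cone_over X \<noteq> {}"
  proof -
    obtain x where "x \<in> X" using polyhedral_open_convex(4)[OF assms] by blast
    then have "lift x \<in> cone_over X" by (simp add: cone_over_iff lift_def)
    then show ?thesis by blast
  qed
  have "finite A0" using fin by (simp add: A0_def)
  then obtain A where A: "A \<subseteq> A0" "irredundant A" "opencone A = opencone A0"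
    using irredundant_subset[of A0] ne A0 by auto
  obtain R where R: "R > 0" "\<And>x. x \<in> X \<Longrightarrow> norm x \<le> R"
    using polyhedral_open_convex(3)[OF assms] bounded_pos by blast
  define S where "S = {u :: 'a \<times> real. norm u \<le> (R + 1) * ((0, 1) \<bullet> u)}"
  have "cone_over X \<subseteq> S"
  proof
    fix u assume "u \<in> cone_over X"
    then obtain l x where u: "u = l *\<^sub>R lift x" "l > 0" "x \<in> X" by (auto simp: cone_over_def)
    have "norm (lift x) \<le> norm x + 1" unfolding lift_def using norm_Pair_le[of x "1::real"] by simp
    also have "\<dots> \<le> R + 1" using R(2)[OF u(3)] by simp
    finally have "l * norm (lift x) \<le> l * (R + 1)" using u(2) by simp
    then have "norm u \<le> (R + 1) * l" using u(1,2) by (simp add: mult.commute)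
    moreover have "(0, 1) \<bullet> u = l" using u(1) by (simp add: inner_pair_unit lift_def)
    ultimately show "u \<in> S" by (simp add: S_def)
  qed
  moreover have "closed S" unfolding S_def by (intro closed_Collect_le continuous_intros)
  ultimately have "closure (cone_over X) \<subseteq> S" by (rule closure_minimal)
  then have "closedcone A \<subseteq> S" using closure_opencone[of A] A A0 ne by simp
  then show thesis
    using \<open>finite A0\<close> A A0 R by (intro that[of A "R + 1"]) (auto simp: S_def finite_subset)
qed

lemma lift_closure:
  assumes A: "opencone A = cone_over X" and ne: "X \<noteq> {}"
  shows "lift x \<in> closedcone A \<longleftrightarrow> x \<in> closure (X :: 'a::euclidean_space set)"
proof
  have liftX: "lift y \<in> opencone A" if "y \<in> X" for y
    unfolding A using that by (simp add: cone_over_iff lift_def)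
  assume x: "lift x \<in> closedcone A"
  obtain y where y: "y \<in> X" using ne by blast
  have "x + t *\<^sub>R (y - x) \<in> X" if t: "0 < t" "t \<le> 1" for t
  proof -
    have "(1 - t) *\<^sub>R lift x + t *\<^sub>R lift y \<in> opencone A"
      using t by (intro closedcone_add_opencone closedcone_scale[OF x] opencone_scale[OF liftX[OF y]]) auto
    then show ?thesis unfolding A by (simp add: cone_over_iff lift_def algebra_simps)
  qed
  then have "\<forall>\<^sub>F t in at_right 0. x + t *\<^sub>R (y - x) \<in> closure X"
    using closure_subset[of X] unfolding eventually_at_right_field by (intro exI[of _ 1]) force
  then show "x \<in> closure X"
    by (rule Lim_in_closed_set[OF closed_closure _ trivial_limit_at_right_real tendsto_line])
next
  assume x: "x \<in> closure X"
  have "continuous_on (closure X) lift" unfolding lift_def by (intro continuous_intros)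
  moreover have "lift ` X \<subseteq> closedcone A"
    using opencone_subset_closedcone[of A] unfolding A by (force simp: cone_over_iff lift_def)
  ultimately show "lift x \<in> closedcone A"
    using image_closure_subset[OF _ closed_closedcone] x by blast
qed

text \<open>Otherwise the segment from \<open>v'\<close> to \<open>v\<close> could be prolonged
  beyond \<open>v\<close> inside the closure of \<open>X\<close>, against extremality.\<close>

lemma extreme_points_separated:
  assumes A: "finite A" "opencone A = cone_over X" and ne: "X \<noteq> {}"
    and v: "v extreme_point_of closure X" "v' \<in> closure X" "v \<noteq> (v' :: 'a::euclidean_space)"
  shows "\<exists>i\<in>active A (lift v). i \<bullet> lift v' > 0"
proof (rule ccontr)
  assume "\<not> ?thesis"
  moreover have "lift v \<in> closedcone A" "lift v' \<in> closedcone A"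
    using v lift_closure[OF A(2) ne] by (auto simp: extreme_point_of_def)
  ultimately have z: "lift v \<in> closedcone A" and zero: "\<And>i. i \<in> active A (lift v) \<Longrightarrow> i \<bullet> lift v' = 0"
    by (force simp: closedcone_def active_def)+
  have "lift v \<in> opencone (A - active A (lift v))"
    using z by (force simp: opencone_def closedcone_def active_def)
  then obtain \<epsilon> where \<epsilon>: "\<epsilon> > 0"
    "lift v + \<epsilon> *\<^sub>R (lift v - lift v') \<in> opencone (A - active A (lift v))"
    using opencone_small_step[of "A - active A (lift v)"] A by blast
  have "0 \<le> i \<bullet> (lift v + \<epsilon> *\<^sub>R (lift v - lift v'))" if "i \<in> A" for i
  proof (cases "i \<in> active A (lift v)")
    case True
    then show ?thesis using zero[OF True] by (simp add: active_def inner_add_right inner_diff_right)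
  next
    case False
    then show ?thesis using \<epsilon>(2) that by (auto simp: opencone_def less_imp_le)
  qed
  then have "lift v + \<epsilon> *\<^sub>R (lift v - lift v') \<in> closedcone A" by (simp add: closedcone_def)
  moreover have "lift v + \<epsilon> *\<^sub>R (lift v - lift v') = lift (v + \<epsilon> *\<^sub>R (v - v'))"
    by (simp add: lift_def)
  ultimately have "v + \<epsilon> *\<^sub>R (v - v') \<in> closure X" using lift_closure[OF A(2) ne] by simp
  moreover have "v \<in> open_segment v' (v + \<epsilon> *\<^sub>R (v - v'))"
    using \<epsilon>(1) v(3) by (intro open_segment_extension) auto
  ultimately show False using v by (auto simp: extreme_point_of_def)
qed

section \<open>Parts of the horoboundary in terms of gauges\<close>

text \<open>After exponentiation the normalisations at the base-points amount to one positive
  constant.\<close>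

lemma induced_map_exp:
  assumes g: "inj_on g X" "g ` X = Y" "bY \<in> Y"
    and pos: "\<And>w. w \<in> X \<Longrightarrow> 0 < hA w" "\<And>y. y \<in> Y \<Longrightarrow> 0 < hB y"
    and eq: "induced_map X Y bY g (restr X (\<lambda>w. ln (hA w) - cA)) = restr Y (\<lambda>y. ln (hB y) - cB)"
  obtains K where "K > 0" "\<And>w. w \<in> X \<Longrightarrow> hA w = K * hB (g w)"
proof -
  obtain b where b: "b \<in> X" "g b = bY" using g by blast
  define K where "K = exp (ln (hA b) - cB)"
  have "hA w = K * hB (g w)" if w: "w \<in> X" for w
  proof -
    have gw: "g w \<in> Y" using g w by blast
    have "induced_map X Y bY g (restr X (\<lambda>w. ln (hA w) - cA)) (g w) = ln (hA w) - ln (hA b)"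
      using inv_into_f_f[OF g(1) w] inv_into_f_f[OF g(1) b(1)] w b gw
      by (simp add: induced_map_def restr_def)
    then have "ln (hA w) = ln (hA b) - cB + ln (hB (g w))"
      using gw unfolding eq by (simp add: restr_def)
    then have "exp (ln (hA w)) = K * exp (ln (hB (g w)))"
      unfolding K_def by (simp only: exp_add)
    then show ?thesis using pos w gw by simp
  qed
  then show thesis using that[of K] by (simp add: K_def)
qed

lemma setcompr2_cong:
  assumes "\<And>x p. x \<in> F \<Longrightarrow> p \<in> U \<Longrightarrow> f x p = h x p"
  shows "{f x p | x p. x \<in> F \<and> p \<in> U} = {h x p | x p. x \<in> F \<and> p \<in> U}"
  by (intro Collect_cong ex_cong1) (auto simp: assms)

text \<open>Each summand is the logarithm of a gauge by \<open>Mfun_opencone\<close>, and positivity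
  of the gauges lets the logarithms combine.\<close>

lemma part_set_opencone:
  assumes fin: "finite A" "finite T" "T \<noteq> {}" and TA: "T \<subseteq> A"
    and X: "opencone A = cone_over X" "b \<in> X"
    and F: "\<And>x. x \<in> F \<Longrightarrow> x \<in> closedcone A \<and> (\<exists>i\<in>A. i \<bullet> x > 0)"
  shows "part_set X b F (opencone T) =
    {restr X (\<lambda>w. ln (mx A x (lift w) * mx T (lift w) p) - ln (mx A x (lift b) * mx T (lift b) p)) | x p.
       x \<in> F \<and> p \<in> opencone T}"
proof -
  have liftX: "lift w \<in> opencone A" if "w \<in> X" for w
    using that unfolding X(1) by (simp add: cone_over_iff lift_def)
  have neA: "A \<noteq> {}" using fin TA by blast
  have T: "opencone A \<subseteq> opencone T" using TA by (auto simp: opencone_def)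
  have eq: "rev_funk (cone_over X) (lift w) x + funk (opencone T) (lift w) p
      = ln (mx A x (lift w) * mx T (lift w) p)" if "x \<in> F" "p \<in> opencone T" "w \<in> X" for x p w
  proof -
    have w: "lift w \<in> opencone A" "lift w \<in> opencone T" using liftX that T by auto
    have "mx A x (lift w) > 0" using F[OF that(1)] mx_pos[OF fin(1) w(1)] by blast
    moreover have "mx T (lift w) p > 0" by (rule mx_pos_opencone[OF fin(2,3) that(2) w(2)])
    moreover have "lift w \<in> closedcone T" using w opencone_subset_closedcone by blast
    ultimately show ?thesis
      using Mfun_opencone[OF fin(1) neA w(1)] Mfun_opencone[OF fin(2,3) that(2)] F[OF that(1)]
      unfolding rev_funk_def funk_def X(1)[symmetric] by (simp add: ln_mult)
  qed
  have "restr X (\<lambda>w. r_fun b (cone_over X) x w + f_fun b (opencone T) p w) =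
    restr X (\<lambda>w. ln (mx A x (lift w) * mx T (lift w) p) - ln (mx A x (lift b) * mx T (lift b) p))"
    if "x \<in> F" "p \<in> opencone T" for x p
  proof
    fix w
    show "restr X (\<lambda>w. r_fun b (cone_over X) x w + f_fun b (opencone T) p w) w =
      restr X (\<lambda>w. ln (mx A x (lift w) * mx T (lift w) p) - ln (mx A x (lift b) * mx T (lift b) p)) w"
      using eq[OF that, of w] eq[OF that X(2)] unfolding restr_def r_fun_def f_fun_def
      by (cases "w \<in> X") simp_all
  qed
  then show ?thesis unfolding part_set_def by (rule setcompr2_cong)
qed

text \<open>The constant left over by the base-points is absorbed by rescaling \<open>x\<close> or
  \<open>p\<close>, whose ranges are invariant under positive scaling.\<close>

lemma vertex_part_to_facet:
  fixes X Y :: "'a::euclidean_space set"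
  assumes A: "finite A" "opencone A = cone_over X" and X: "X \<noteq> {}" "bX \<in> X"
    and B: "finite B" "opencone B = cone_over Y" "irredundant B" "bY \<in> Y"
      "\<And>u. u \<in> closedcone B \<Longrightarrow> norm u \<le> \<kappa> * ((0, 1) \<bullet> u)"
    and g: "inj_on g X" "g ` X = Y"
    and parts: "\<forall>P. vertex_part X bX P \<longrightarrow> facet_part Y bY (induced_map X Y bY g ` P)"
    and v: "v extreme_point_of closure X" "active A (lift v) \<noteq> {}" "i \<in> A" "i \<bullet> lift v > 0"
  obtains a where "a \<in> B"
    "\<And>p. p \<in> opencone (active A (lift v)) \<Longrightarrow> \<exists>x\<in>facet B a. \<forall>w\<in>X.
       mx A (lift v) (lift w) * mx (active A (lift v)) (lift w) p = (a \<bullet> lift (g w)) * mx B x (lift (g w))"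
    "\<And>x. x \<in> facet B a \<Longrightarrow> \<exists>p\<in>opencone (active A (lift v)). \<forall>w\<in>X.
       mx A (lift v) (lift w) * mx (active A (lift v)) (lift w) p = (a \<bullet> lift (g w)) * mx B x (lift (g w))"
proof -
  let ?v = "lift v" and ?T = "active A (lift v)"
  have vA: "?v \<in> closedcone A" using v lift_closure[OF A(2) X(1)] by (simp add: extreme_point_of_def)
  have finT: "finite ?T" using A by (simp add: active_def)
  have liftX: "lift w \<in> opencone A" if "w \<in> X" for w
    using that unfolding A(2) by (simp add: cone_over_iff lift_def)
  have liftY: "lift w \<in> opencone B" if "w \<in> Y" for w
    using that unfolding B(2) by (simp add: cone_over_iff lift_def)
  define F where "F = {l *\<^sub>R ?v | l. l > 0}"
  have F: "x \<in> closedcone A \<and> (\<exists>i\<in>A. i \<bullet> x > 0)" if "x \<in> F" for x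
  proof -
    obtain l where "l > 0" "x = l *\<^sub>R ?v" using \<open>x \<in> F\<close> by (auto simp: F_def)
    then show ?thesis using v(3,4) vA by (auto intro!: closedcone_scale bexI[of _ i])
  qed
  define P where "P = part_set X bX F (opencone ?T)"
  have "?v = 1 *\<^sub>R ?v \<and> (0::real) < 1" by simp
  then have vF: "?v \<in> F" unfolding F_def by blast
  have "P = part_set X bX F (tangent_cone (cone_over X) ?v)"
    using tangent_cone_opencone[OF A(1) vA] by (simp only: P_def A(2))
  then have "vertex_part X bX P"
    unfolding vertex_part_def using v(1) vF F_def by blast
  then have "facet_part Y bY (induced_map X Y bY g ` P)" using parts by blast
  then obtain G F' z where G: "G face_of closure (cone_over Y)" "aff_dim G = int DIM('a)"
      "F' = rel_interior G" "z \<in> F'"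
    and part: "induced_map X Y bY g ` P = part_set Y bY F' (tangent_cone (cone_over Y) z)"
    unfolding facet_part_def by (elim exE conjE)
  have neB: "opencone B \<noteq> {}" using liftY B by blast
  obtain a where a: "a \<in> B" "F' = facet B a"
    using face_is_facet[OF B(1) neB B(3), of G] G closure_opencone[OF neB] B(2) by auto
  have zB: "z \<in> closedcone B" using a G facet_subset_closedcone by blast
  have "z \<in> facet B a" using G(4) a(2) by simp
  \<comment> \<open>At a point of the open facet the tangent cone is a half-space with gauge
    \<open>(a \<bullet> u) / (a \<bullet> p)\<close>, the source of the factor
    \<open>a \<bullet> lift (g w)\<close>.\<close>
  then have act: "active B z = {a}" using a(1) by (force simp: active_def facet_def)
  have F': "x \<in> closedcone B \<and> (\<exists>b\<in>B. b \<bullet> x > 0)" if x: "x \<in> facet B a" for x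
  proof (intro conjI)
    show xB: "x \<in> closedcone B" using x facet_subset_closedcone by blast
    show "\<exists>b\<in>B. b \<bullet> x > 0"
    proof (rule ccontr)
      assume "\<not> ?thesis"
      then have "B \<subseteq> {a}" using x by (auto simp: facet_def)
      then have Ba: "B = {a}" using a by blast
      \<comment> \<open>With \<open>a\<close> as the only functional the cone would contain a line,
        since the ambient dimension is at least two.\<close>
      obtain u where u: "u \<noteq> 0" "orthogonal a u"
        by (rule orthogonal_to_vector_exists[of a]) (use DIM_positive[where 'a='a] in auto)
      then have "u \<in> closedcone B" "- u \<in> closedcone B" by (auto simp: Ba closedcone_def orthogonal_def)
      with norm_bound_antisym[OF B(5) B(5)] u(1) show False by blast
    qed
  qed
  have part': "part_set Y bY F' (tangent_cone (cone_over Y) z) =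
    {restr Y (\<lambda>w. ln (mx B x (lift w) * mx {a} (lift w) p) - ln (mx B x (lift bY) * mx {a} (lift bY) p)) | x p.
       x \<in> facet B a \<and> p \<in> opencone {a}}"
    using part_set_opencone[of B "{a}" Y bY "facet B a"] a B F' tangent_cone_opencone[OF B(1) zB]
    by (simp add: act)
  have P: "P = {restr X (\<lambda>w. ln (mx A x (lift w) * mx ?T (lift w) p) - ln (mx A x (lift bX) * mx ?T (lift bX) p)) | x p.
       x \<in> F \<and> p \<in> opencone ?T}"
    unfolding P_def using F X
    by (intro part_set_opencone A finT v) (auto simp: active_def)
  have mxa: "mx {a} u p = (a \<bullet> u) / (a \<bullet> p)" for u p by (simp add: mx_def)
  have match: "\<exists>K>0. \<forall>w\<in>X. mx A ?v (lift w) * mx ?T (lift w) p = K * ((a \<bullet> lift (g w)) * mx B x (lift (g w)))"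
    if l: "l > 0" and p: "p \<in> opencone ?T" and x: "x \<in> facet B a" and p': "p' \<in> opencone {a}" and
      eq: "induced_map X Y bY g (restr X (\<lambda>w. ln (mx A (l *\<^sub>R ?v) (lift w) * mx ?T (lift w) p) - cA)) =
         restr Y (\<lambda>w. ln (mx B x (lift w) * mx {a} (lift w) p') - cB)" for l p x p' cA cB
  proof -
    have neA: "A \<noteq> {}" using v by blast
    have lF: "l *\<^sub>R ?v \<in> F" using l by (auto simp: F_def)
    obtain K where K: "K > 0" "\<And>w. w \<in> X \<Longrightarrow>
        mx A (l *\<^sub>R ?v) (lift w) * mx ?T (lift w) p = K * (mx B x (lift (g w)) * mx {a} (lift (g w)) p')"
    proof (rule induced_map_exp[OF g B(4) _ _ eq])
      show "0 < mx A (l *\<^sub>R ?v) (lift w) * mx ?T (lift w) p" if "w \<in> X" for w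
      proof (rule mult_pos_pos)
        show "0 < mx A (l *\<^sub>R ?v) (lift w)" using F[OF lF] mx_pos[OF A(1) liftX[OF that]] by blast
        show "0 < mx ?T (lift w) p"
          using liftX[OF that] opencone_active by (intro mx_pos_opencone[OF finT v(2) p]) blast
      qed
      show "0 < mx B x (lift y) * mx {a} (lift y) p'" if "y \<in> Y" for y
      proof (rule mult_pos_pos)
        show "0 < mx B x (lift y)" using F'[OF x] mx_pos[OF B(1) liftY[OF that]] by blast
        show "0 < mx {a} (lift y) p'" using liftY[OF that] a(1) p' by (simp add: mxa opencone_def)
      qed
    qed (rule that)
    have ap: "a \<bullet> p' > 0" using p' by (simp add: opencone_def)
    have "mx A ?v (lift w) * mx ?T (lift w) p = K / (l * (a \<bullet> p')) * ((a \<bullet> lift (g w)) * mx B x (lift (g w)))"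
      if "w \<in> X" for w
      using K(2)[OF that] l ap by (simp add: mx_scale_left[OF A(1) neA] mxa field_simps)
    moreover have "K / (l * (a \<bullet> p')) > 0" using K l ap by simp
    ultimately show ?thesis by blast
  qed
  have neB': "B \<noteq> {}" using a by blast
  show thesis
  proof (rule that[OF a(1)])
    fix p assume p: "p \<in> opencone ?T"
    let ?\<xi> = "restr X (\<lambda>w. ln (mx A (1 *\<^sub>R ?v) (lift w) * mx ?T (lift w) p) - ln (mx A (1 *\<^sub>R ?v) (lift bX) * mx ?T (lift bX) p))"
    have "1 *\<^sub>R ?v \<in> F" using vF by simp
    then have "?\<xi> \<in> P" unfolding P using p by blast
    then have "induced_map X Y bY g ?\<xi> \<in> induced_map X Y bY g ` P" by blast
    then obtain x p' where x: "x \<in> facet B a" "p' \<in> opencone {a}" and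
      "induced_map X Y bY g ?\<xi> = restr Y (\<lambda>w. ln (mx B x (lift w) * mx {a} (lift w) p') - ln (mx B x (lift bY) * mx {a} (lift bY) p'))"
      unfolding part part' by blast
    from match[OF zero_less_one p this] obtain K where K: "K > 0"
      "\<forall>w\<in>X. mx A ?v (lift w) * mx ?T (lift w) p = K * ((a \<bullet> lift (g w)) * mx B x (lift (g w)))" by blast
    then show "\<exists>x\<in>facet B a. \<forall>w\<in>X. mx A ?v (lift w) * mx ?T (lift w) p = (a \<bullet> lift (g w)) * mx B x (lift (g w))"
      using facet_scale[OF x(1) K(1)]
      by (intro bexI[of _ "K *\<^sub>R x"]) (simp_all add: mx_scale_left[OF B(1) neB'])
  next
    fix x assume x: "x \<in> facet B a"
    obtain p' where p': "p' \<in> opencone {a}" using neB a by (auto simp: opencone_def)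
    let ?\<eta> = "restr Y (\<lambda>w. ln (mx B x (lift w) * mx {a} (lift w) p') - ln (mx B x (lift bY) * mx {a} (lift bY) p'))"
    have "?\<eta> \<in> induced_map X Y bY g ` P" unfolding part part' using x p' by blast
    then obtain \<xi> where \<xi>: "\<xi> \<in> P" "?\<eta> = induced_map X Y bY g \<xi>" by blast
    from \<xi>(1) obtain y p where y: "y \<in> F" "p \<in> opencone ?T" and
      \<xi>': "\<xi> = restr X (\<lambda>w. ln (mx A y (lift w) * mx ?T (lift w) p) - ln (mx A y (lift bX) * mx ?T (lift bX) p))"
      unfolding P by blast
    obtain l where l: "l > 0" "y = l *\<^sub>R ?v" using y by (auto simp: F_def)
    from match[OF l(1) y(2) x p' \<xi>(2)[symmetric, unfolded \<xi>' l(2)]] obtain K where K: "K > 0"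
      "\<forall>w\<in>X. mx A ?v (lift w) * mx ?T (lift w) p = K * ((a \<bullet> lift (g w)) * mx B x (lift (g w)))" by blast
    then show "\<exists>p\<in>opencone ?T. \<forall>w\<in>X. mx A ?v (lift w) * mx ?T (lift w) p = (a \<bullet> lift (g w)) * mx B x (lift (g w))"
      using opencone_scale[OF y(2) K(1)]
      by (intro bexI[of _ "K *\<^sub>R p"]) (simp_all add: mx_scale_right[OF finT v(2)])
  qed
qed

section \<open>Counting the vertices of \<open>X\<close> and spanning the cone over
  \<open>Y\<close>\<close>

theorem theorem7p1:
  fixes X Y :: "'a::euclidean_space set" and g :: "'a \<Rightarrow> 'a" and bX bY :: 'a
  assumes "DIM('a) \<ge> 2"
    and "polyhedral_hilbert X" and "polyhedral_hilbert Y"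
    and "bX \<in> X" and "bY \<in> Y"
    and "g ` X = Y"
    and "\<forall>x\<in>X. \<forall>y\<in>X. hilbert_dist Y (g x) (g y) = hilbert_dist X x y"
    and "\<forall>P. vertex_part X bX P \<longrightarrow> facet_part Y bY (induced_map X Y bY g ` P)"
  shows "open_simplex X \<and> open_simplex Y"
proof -
  note oX = polyhedral_open_convex[OF assms(2)] and oY = polyhedral_open_convex[OF assms(3)]
  have inj: "inj_on g X"
  proof (rule inj_onI, rule ccontr)
    fix x y assume xy: "x \<in> X" "y \<in> X" "g x = g y" "x \<noteq> y"
    then have "hilbert_dist X x y = hilbert_dist Y (g x) (g y)" using assms(7) by metis
    also have "\<dots> = 0" using xy by (simp add: hilbert_dist_def)
    finally show False using hilbert_dist_pos[OF oX(1-3) xy(1,2,4)] by simp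
  qed
  obtain A \<kappa>A where A: "finite A" "irredundant A" "opencone A = cone_over X" "\<kappa>A > 0"
    "\<And>u. u \<in> closedcone A \<Longrightarrow> norm u \<le> \<kappa>A * ((0, 1) \<bullet> u)"
    using polyhedral_cone[OF assms(2)] by blast
  obtain B \<kappa> where B: "finite B" "irredundant B" "opencone B = cone_over Y" "\<kappa> > 0"
    "\<And>u. u \<in> closedcone B \<Longrightarrow> norm u \<le> \<kappa> * ((0, 1) \<bullet> u)"
    using polyhedral_cone[OF assms(3)] by blast
  have liftX: "lift w \<in> opencone A" if "w \<in> X" for w
    using that unfolding A(3) by (simp add: cone_over_iff lift_def)
  have liftY: "lift w \<in> opencone B" if "w \<in> Y" for w
    using that unfolding B(3) by (simp add: cone_over_iff lift_def)
  define W where "W = {(s *\<^sub>R lift w, t *\<^sub>R lift (g w)) | s t w. s > 0 \<and> t > 0 \<and> w \<in> X}"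
  interpret cone_correspondence B "(0, 1)" \<kappa> A W
  proof
    show "W \<subseteq> opencone A \<times> opencone B"
      using assms(6) liftX liftY by (auto simp: W_def intro!: opencone_scale)
    show "\<exists>u'. (u, u') \<in> W" if u: "u \<in> opencone A" for u
    proof -
      obtain s w where "u = s *\<^sub>R lift w" "s > 0" "w \<in> X" using u unfolding A(3) cone_over_def by blast
      then have "(u, 1 *\<^sub>R lift (g w)) \<in> W" unfolding W_def using zero_less_one by blast
      then show ?thesis by blast
    qed
    show "\<exists>u. (u, u') \<in> W" if u': "u' \<in> opencone B" for u'
    proof -
      obtain t y where "u' = t *\<^sub>R lift y" "t > 0" "y \<in> Y" using u' unfolding B(3) cone_over_def by blast
      moreover from this obtain w where "w \<in> X" "y = g w" using assms(6) by blast
      ultimately have "(1 *\<^sub>R lift w, u') \<in> W" unfolding W_def using zero_less_one by blast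
      then show ?thesis by blast
    qed
    show "opencone A \<noteq> {}" "opencone B \<noteq> {}" using liftX liftY assms(4,5) by auto
  qed (use A B in auto)
  define E where "E = {v. v extreme_point_of closure X}"
  have sep: "separated (lift v) (lift v')" if "v \<in> E" "v' \<in> E" "v \<noteq> v'" for v v'
    using extreme_points_separated[OF A(1,3) oX(4), of v v'] that
    by (auto simp: E_def separated_def extreme_point_of_def)
  \<comment> \<open>A second extreme point provides a functional active at \<open>lift v\<close> and
    another one positive there.\<close>
  have vf: "\<exists>a. vertex_to_facet (lift v) a" if v: "v \<in> E" "v' \<in> E" "v \<noteq> v'" for v v'
  proof -
    have ne: "active A (lift v) \<noteq> {}" using sep[OF v] by (auto simp: separated_def)
    have vA: "lift v \<in> closedcone A"
      using v lift_closure[OF A(3) oX(4)] by (simp add: E_def extreme_point_of_def)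
    obtain i where i: "i \<in> A" "i \<bullet> lift v > 0"
      using sep[OF v(2,1)] v(3) by (auto simp: separated_def active_def)
    have vE: "v extreme_point_of closure X" using v by (simp add: E_def)
    obtain a where a: "a \<in> B"
      "\<And>p. p \<in> opencone (active A (lift v)) \<Longrightarrow> \<exists>x\<in>facet B a. \<forall>w\<in>X.
         mx A (lift v) (lift w) * mx (active A (lift v)) (lift w) p = (a \<bullet> lift (g w)) * mx B x (lift (g w))"
      "\<And>x. x \<in> facet B a \<Longrightarrow> \<exists>p\<in>opencone (active A (lift v)). \<forall>w\<in>X.
         mx A (lift v) (lift w) * mx (active A (lift v)) (lift w) p = (a \<bullet> lift (g w)) * mx B x (lift (g w))"
      using vertex_part_to_facet[OF A(1,3) oX(4) assms(4) B(1,3,2) assms(5) B(5) inj assms(6,8) vE ne i]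
      by blast
    have "corr (lift v) a p x"
      if p: "p \<in> opencone (active A (lift v))" and x: "x \<in> facet B a" and
        eq: "\<forall>w\<in>X. mx A (lift v) (lift w) * mx (active A (lift v)) (lift w) p = (a \<bullet> lift (g w)) * mx B x (lift (g w))"
      for p x
    proof -
      have neA': "A \<noteq> {}" "B \<noteq> {}" using i a by auto
      \<comment> \<open>Both sides are invariant under the scalings by \<open>s\<close> and
        \<open>t\<close>: on each, the two factors scale inversely.\<close>
      have "mx A (lift v) (s *\<^sub>R lift w) * mx (active A (lift v)) (s *\<^sub>R lift w) p
          = (a \<bullet> (t *\<^sub>R lift (g w))) * mx B x (t *\<^sub>R lift (g w))" if "s > 0" "t > 0" "w \<in> X" for s t w
        using eq that
        by (simp add: mx_scale_left[OF fin_active ne] mx_scale_right[OF finA neA'(1)] mx_scale_right[OF finB neA'(2)])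
      then have "mx A (lift v) u * mx (active A (lift v)) u p = (a \<bullet> u') * mx B x u'" if "(u, u') \<in> W" for u u'
        using that unfolding W_def by blast
      then show ?thesis unfolding corr_def using p x by blast
    qed
    then have "vertex_to_facet (lift v) a"
      unfolding vertex_to_facet_def using vA ne i a by blast
    then show ?thesis by blast
  qed
  have dual: "\<exists>d k. (\<forall>v\<in>V. d v \<in> closedcone B \<and> k v \<in> B) \<and>
      (\<forall>v\<in>V. \<forall>v'\<in>V. k v \<bullet> d v' = (if v = v' then 1 else 0))"
    if V: "V \<subseteq> lift ` E" "\<exists>v\<in>V. \<exists>v'\<in>V. v \<noteq> v'" for V
  proof -
    obtain v0 v1 where v01: "v0 \<in> V" "v1 \<in> V" "v0 \<noteq> v1" using V by blast
    have "\<exists>a. vertex_to_facet v a" if v: "v \<in> V" for v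
    proof -
      obtain v' where "v' \<in> V" "v \<noteq> v'" using v01 by metis
      with v V(1) obtain w w' where "v = lift w" "v' = lift w'" "w \<in> E" "w' \<in> E" "w \<noteq> w'" by blast
      then show ?thesis using vf by blast
    qed
    then obtain k where k: "\<And>v. v \<in> V \<Longrightarrow> vertex_to_facet v (k v)" by metis
    have s: "separated v v'" if "v \<in> V" "v' \<in> V" "v \<noteq> v'" for v v'
      using that V(1) sep by blast
    have "\<exists>d. (\<forall>v\<in>V. d v \<in> closedcone B \<and> k v \<in> B) \<and>
        (\<forall>v\<in>V. \<forall>v'\<in>V. k v \<bullet> d v' = (if v = v' then 1 else 0))"
      by (rule dual_system[OF v01 k s])
    then obtain d where "(\<forall>v\<in>V. d v \<in> closedcone B \<and> k v \<in> B) \<and>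
        (\<forall>v\<in>V. \<forall>v'\<in>V. k v \<bullet> d v' = (if v = v' then 1 else 0))" ..
    then show ?thesis by (intro exI[of _ d] exI[of _ k])
  qed
  have inj_lift: "inj_on lift S" for S :: "'a set" by (auto simp: inj_on_def lift_def)
  \<comment> \<open>Finite subsets are counted first; finiteness of \<open>E\<close> follows from
    the uniform bound.\<close>
  have card_le: "card V \<le> DIM('a) + 1" if V: "finite V" "V \<subseteq> E" for V
  proof (cases "card V \<le> 1")
    case False
    then have "\<exists>v\<in>V. \<exists>v'\<in>V. v \<noteq> v'" using card_le_Suc0_iff_eq[OF V(1)] by auto
    then have "\<exists>v\<in>lift ` V. \<exists>v'\<in>lift ` V. v \<noteq> v'" using inj_lift[of V] by (auto simp: inj_on_def)
    from dual[OF image_mono[OF V(2)] this] obtain d k :: "'a \<times> real \<Rightarrow> 'a \<times> real"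
      where "\<forall>v\<in>lift ` V. \<forall>v'\<in>lift ` V. k v \<bullet> d v' = (if v = v' then 1 else 0)"
      by (elim exE conjE)
    then have "k v \<bullet> d v' = (if v = v' then 1 else 0)" if "v \<in> lift ` V" "v' \<in> lift ` V" for v v'
      using that by blast
    then have "card (lift ` V) \<le> DIM('a \<times> real)"
      by (rule dual_independent(1)[OF finite_imageI[OF V(1)]])
    then show ?thesis by (simp add: card_image[OF inj_lift])
  qed simp
  have E: "finite E" "card E \<le> DIM('a) + 1"
    using finite_if_finite_subsets_card_bdd[of E "DIM('a) + 1"] card_le by auto
  have "compact (closure X)" "convex (closure X)" using oX by (auto simp: compact_closure convex_closure)
  then have hull: "closure X = convex hull E" unfolding E_def by (rule Krein_Milman_Minkowski)
  have sX: "open_simplex X" and cE: "card E = DIM('a) + 1"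
    using open_simplexI[OF oX(1,2,4) hull E] by auto
  let ?V = "lift ` E"
  have cV: "card ?V = DIM('a \<times> real)" using cE by (simp add: card_image[OF inj_lift])
  have "\<exists>v\<in>E. \<exists>v'\<in>E. v \<noteq> v'" using card_le_Suc0_iff_eq[OF E(1)] cE DIM_positive[where 'a='a] by fastforce
  then have "\<exists>v\<in>?V. \<exists>v'\<in>?V. v \<noteq> v'" using inj_lift[of E] by (auto simp: inj_on_def)
  from dual[OF subset_refl this] obtain d k where dk': "\<forall>v\<in>?V. d v \<in> closedcone B \<and> k v \<in> B"
    "\<forall>v\<in>?V. \<forall>v'\<in>?V. k v \<bullet> d v' = (if v = v' then 1 else 0)"
    by (elim exE conjE)
  then have d: "\<And>v. v \<in> ?V \<Longrightarrow> d v \<in> closedcone B" and kB: "\<And>v. v \<in> ?V \<Longrightarrow> k v \<in> B"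
    by blast+
  have dk: "k v \<bullet> d v' = (if v = v' then 1 else 0)" if "v \<in> ?V" "v' \<in> ?V" for v v'
    using dk'(2) that by blast
  have finV: "finite ?V" using E by simp
  \<comment> \<open>Positive height lets the ray of \<open>d v\<close> meet the slice of height
    \<open>1\<close> that carries the closure of \<open>Y\<close>, in the point
    \<open>lift (q v)\<close>.\<close>
  have sd: "snd (d v) > 0" if v: "v \<in> ?V" for v
  proof -
    have "d v \<noteq> 0" using dk[OF v v] by auto
    then have "0 < norm (d v)" by simp
    also have "\<dots> \<le> \<kappa> * snd (d v)" using B(5)[OF d[OF v]] by (simp only: inner_pair_unit)
    finally have "0 < \<kappa> * snd (d v)" .
    then show ?thesis using B(4) by (simp add: zero_less_mult_iff)
  qed
  define q where "q = (\<lambda>v. (1 / snd (d v)) *\<^sub>R fst (d v))"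
  have hullY: "closure Y = convex hull (q ` ?V)"
  proof
    have "q v \<in> closure Y" if v: "v \<in> ?V" for v
    proof -
      have "lift (q v) = (1 / snd (d v)) *\<^sub>R d v" using sd[OF v] by (simp add: q_def lift_def prod_eq_iff)
      also have "\<dots> \<in> closedcone B" using sd[OF v] by (intro closedcone_scale d v) auto
      finally show ?thesis using lift_closure[OF B(3) oY(4)] by blast
    qed
    then show "convex hull (q ` ?V) \<subseteq> closure Y" using oY by (intro hull_minimal convex_closure) auto
    show "closure Y \<subseteq> convex hull (q ` ?V)"
    proof
      fix y assume "y \<in> closure Y"
      then have y: "lift y \<in> closedcone B" using lift_closure[OF B(3) oY(4)] by blast
      \<comment> \<open>Expanding \<open>lift y\<close> in the basis \<open>d\<close> gives
        barycentric coordinates of \<open>y\<close>: they are nonnegative because \<open>k v\<close>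
        is in \<open>B\<close>, and the last coordinate of \<open>lift y\<close> makes their sum
        \<open>1\<close>.\<close>
      define c where "c = (\<lambda>v. (k v \<bullet> lift y) * snd (d v))"
      have c0: "c v \<ge> 0" if "v \<in> ?V" for v
        using y kB[OF that] sd[OF that] by (simp add: c_def closedcone_def)
      have exp: "lift y = (\<Sum>v\<in>?V. (k v \<bullet> lift y) *\<^sub>R d v)"
        using dual_independent(2)[OF finV dk cV] by blast
      have "1 = snd (lift y)" by (simp add: lift_def)
      also have "\<dots> = sum c ?V" by (subst exp) (simp add: snd_sum c_def)
      finally have sum1: "sum c ?V = 1" by simp
      have "y = fst (lift y)" by (simp add: lift_def)
      then have "y = (\<Sum>v\<in>?V. (k v \<bullet> lift y) *\<^sub>R fst (d v))" by (subst (asm) exp) (simp add: fst_sum)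
      also have "\<dots> = (\<Sum>v\<in>?V. c v *\<^sub>R q v)"
      proof (intro sum.cong refl)
        fix v assume "v \<in> ?V"
        from sd[OF this] show "(k v \<bullet> lift y) *\<^sub>R fst (d v) = c v *\<^sub>R q v" by (simp add: c_def q_def)
      qed
      also have "\<dots> \<in> convex hull (q ` ?V)"
        using c0 sum1 by (intro convex_sum finV convex_convex_hull) (auto intro: hull_inc)
      finally show "y \<in> convex hull (q ` ?V)" .
    qed
  qed
  have "card (q ` ?V) \<le> DIM('a) + 1" using card_image_le[OF finV, of q] cV by simp
  then have "open_simplex Y"
    using open_simplexI(1)[OF oY(1,2,4) hullY] finV by blast
  with sX show ?thesis by blast
qed

end
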